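(* Let $V=\langle f_1,\dots,f_q\rangle$ be a $K$-point of $\mathbf{Gr}_{S_m}^{q}$ and let $f_1\wedge\dots\wedge f_q=\sum_{L\in\mathbf T_{S_m}^{q}}c_LL$ with $c_L\in K$. Then: (i) $\Delta\mathrm{Supp}(V)=\{L\in\mathbf T_{S_m}^{q}\mid c_L\ne0\}$; (ii) $\wedge^q\mathrm{in}(V)=\langle\mathbf{in}(V)\rangle$, or equivalently $\mathrm{in}(V)=\mathrm{vs}(\mathbf{in}(V))$; (iii) $\wedge^q\mathrm{gin}(V)=\langle\mathbf{gin}(V)\rangle$, or equivalently $\mathrm{gin}(V)=\mathrm{vs}(\mathbf{gin}(V))$, and $\mathbf{gin}(V)$ is Borel.
   Context: $K$ is an infinite field, $S=K[x_0,\dots,x_n]$ with the standard grading, $S_m$ is its degree $m$ component, a term is a monic monomial, $\prec$ is a term order on $S$ with $x_0\prec\dots\prec x_n$, $m,q$ are positive integers. $\mathbf{Gr}_{S_m}^{q}$ is the Grassmannian scheme of $q$-dimensional subspaces of $S_m$, embedded in $\mathbb P(\wedge^qS_m)$ by Plücker; a $K$-point is a $q$-dimensional subspace of $S_m$. $\mathbf T_{S_m}^{q}$ is the set of $\tau_1\wedge\dots\wedge\tau_q$ with $\tau_i$ terms in $S_m$, $\tau_1\succ\dots\succ\tau_q$; it is a basis of $\wedge^qS_m$, totally ordered by: $\tau_1\wedge\dots\wedge\tau_q\prec\sigma_1\wedge\dots\wedge\sigma_q$ iff for some $j$, $\tau_i=\sigma_i$ for $i<j$ and $\tau_j\prec\sigma_j$.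 For $L=\tau_1\wedge\dots\wedge\tau_q$, $U_L\subseteq\mathbf{Gr}_{S_m}^{q}$ is the open set where the Plücker coordinate $\Delta_L$ is invertible, $\mathrm{vs}(L)=\langle\tau_1,\dots,\tau_q\rangle$. $\mathrm{GL}=\mathrm{GL}_K(n+1)$ acts on $S$ by $g(f)=f(\sum_j g_{0j}x_j,\dots,\sum_j g_{nj}x_j)$ and correspondingly on $\wedge^qS_m$ and $\mathbf{Gr}_{S_m}^{q}$; $\mathcal O(V)=\{g(V):g\in\mathrm{GL}\}$. $L$ is Borel if $g(L)\in\langle L\rangle$ for every upper-triangular $g\in\mathrm{GL}$. For a non-empty set $W$ of points, $\Delta\mathrm{Supp}(W)=\{L\in\mathbf T_{S_m}^{q}:U_L\cap W\ne\emptyset\}$, $\mathbf{in}(W)=\max_\prec\Delta\mathrm{Supp}(W)$, $\mathbf{gin}(W)=\max_\prec\Delta\mathrm{Supp}(\mathcal O(W))$; for $W=\{V\}$ one writes $\Delta\mathrm{Supp}(V),\mathbf{in}(V),\mathbf{gin}(V)$. For a subspace $V\subseteq S_m$, $\mathrm{in}(V)$ is the subspace spanned by the initial terms (with respect to $\prec$) of the non-zero elements of $V$, and $\mathrm{gin}(V)$ is the constant value of $\mathrm{in}(g(V))$ for $g$ in a suitable non-empty open subset of $\mathrm{GL}$. *)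

theory Defs
  imports
    "HOL-Library.Poly_Mapping"
    "Jordan_Normal_Form.Matrix"
begin

definition pm_scale :: "'k::field \<Rightarrow> ('b \<Rightarrow>\<^sub>0 'k) \<Rightarrow> ('b \<Rightarrow>\<^sub>0 'k)" where
  "pm_scale c = Poly_Mapping.map ((*) c)"

lemma lookup_pm_scale [simp]:
  "Poly_Mapping.lookup (pm_scale c p) b = c * Poly_Mapping.lookup p b"
  by (simp add: pm_scale_def Poly_Mapping.map.rep_eq when_def)

global_interpretation pm: vector_space "pm_scale :: 'k::field \<Rightarrow> ('b \<Rightarrow>\<^sub>0 'k) \<Rightarrow> ('b \<Rightarrow>\<^sub>0 'k)"
  by unfold_locales (auto intro!: poly_mapping_eqI simp: lookup_add algebra_simps)

text \<open>
  The exterior algebra of the vector space \<open>'b \<Rightarrow>\<^sub>0 'k\<close> is the free vector space on the finite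
  lists of vectors, the list \<open>[v\<^sub>1, \<dots>, v\<^sub>q]\<close> standing for \<open>v\<^sub>1 \<and> \<dots> \<and> v\<^sub>q\<close>, modulo the relations
  saying that this expression is additive and homogeneous in every argument and vanishes if two
  arguments coincide. The relations are homogeneous in the length of the lists, so lists of
  length \<open>q\<close> give the \<open>q\<close>-th exterior power.
\<close>

definition ext_relations :: "(('b \<Rightarrow>\<^sub>0 'k::field) list \<Rightarrow>\<^sub>0 'k) set" where
  "ext_relations =
     {Poly_Mapping.single (us @ (v + w) # vs) 1
        - Poly_Mapping.single (us @ v # vs) 1 - Poly_Mapping.single (us @ w # vs) 1
      | us v w vs. True}
   \<union> {Poly_Mapping.single (us @ pm_scale c v # vs) 1 - Poly_Mapping.single (us @ v # vs) c
      | us c v vs. True}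
   \<union> {Poly_Mapping.single (us @ v # vs @ v # ws) 1 | us v vs ws. True}"

definition ext_rel ::
    "(('b \<Rightarrow>\<^sub>0 'k::field) list \<Rightarrow>\<^sub>0 'k) \<Rightarrow> (('b \<Rightarrow>\<^sub>0 'k) list \<Rightarrow>\<^sub>0 'k) \<Rightarrow> bool" where
  "ext_rel x y \<longleftrightarrow> x - y \<in> pm.span ext_relations"

lemma equivp_ext_rel: "equivp ext_rel"
proof (rule equivpI)
  show "reflp ext_rel"
    by (simp add: reflp_def ext_rel_def pm.span_zero)
  show "symp ext_rel"
    unfolding symp_def ext_rel_def using pm.span_neg by fastforce
  show "transp ext_rel"
    unfolding transp_def ext_rel_def using pm.span_add by fastforce
qed

quotient_type (overloaded) ('b, 'k) ext = "('b \<Rightarrow>\<^sub>0 'k::field) list \<Rightarrow>\<^sub>0 'k" / ext_rel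
  by (rule equivp_ext_rel)

instantiation ext :: (type, field) ab_group_add
begin

lift_definition zero_ext :: "('a, 'b) ext" is 0 .

lift_definition plus_ext :: "('a, 'b) ext \<Rightarrow> ('a, 'b) ext \<Rightarrow> ('a, 'b) ext" is "(+)"
  unfolding ext_rel_def by (drule (1) pm.span_add) (simp add: algebra_simps)

lift_definition uminus_ext :: "('a, 'b) ext \<Rightarrow> ('a, 'b) ext" is uminus
  unfolding ext_rel_def by (drule pm.span_neg) simp

lift_definition minus_ext :: "('a, 'b) ext \<Rightarrow> ('a, 'b) ext \<Rightarrow> ('a, 'b) ext" is "(-)"
  unfolding ext_rel_def by (drule (1) pm.span_diff) (simp add: algebra_simps)

instance
  by standard (transfer; simp add: ext_rel_def pm.span_zero algebra_simps)+

end

lift_definition ext_scale :: "'k::field \<Rightarrow> ('b, 'k) ext \<Rightarrow> ('b, 'k) ext" is pm_scale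
  unfolding ext_rel_def by (simp add: pm.span_scale flip: pm.scale_right_diff_distrib)

global_interpretation ext: vector_space "ext_scale :: 'k::field \<Rightarrow> ('b, 'k) ext \<Rightarrow> ('b, 'k) ext"
  by unfold_locales
     (transfer; simp add: ext_rel_def pm.span_zero pm.scale_right_distrib pm.scale_left_distrib)+

definition wedge :: "('b \<Rightarrow>\<^sub>0 'k::field) list \<Rightarrow> ('b, 'k) ext" where
  "wedge vs = abs_ext (Poly_Mapping.single vs 1)"

text \<open>
  Over a field the exterior power of a subspace embeds into that of the whole space; we use its
  image.
\<close>

definition ext_power :: "nat \<Rightarrow> ('b \<Rightarrow>\<^sub>0 'k::field) set \<Rightarrow> ('b, 'k) ext set" where
  "ext_power q V = ext.span {wedge vs | vs. length vs = q \<and> set vs \<subseteq> V}"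

text \<open>
  A term is given by its exponent function; \<open>K[x\<^sub>0, \<dots>, x\<^sub>n]\<close> consists of the elements of \<open>'k pol\<close>
  all of whose terms involve only variables with index at most \<open>n\<close>.
\<close>

type_synonym trm = "nat \<Rightarrow>\<^sub>0 nat"
type_synonym 'k pol = "trm \<Rightarrow>\<^sub>0 'k"

definition terms :: "nat \<Rightarrow> trm set" where
  "terms n = {t. Poly_Mapping.keys t \<subseteq> {..n}}"

definition terms_deg :: "nat \<Rightarrow> nat \<Rightarrow> trm set" where
  "terms_deg n m =
     {t \<in> terms n. (\<Sum>i\<in>Poly_Mapping.keys t. Poly_Mapping.lookup t i) = m}"

definition homogeneous :: "nat \<Rightarrow> nat \<Rightarrow> 'k::field pol set" where
  "homogeneous n m = {f. Poly_Mapping.keys f \<subseteq> terms_deg n m}"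

abbreviation term_pol :: "trm \<Rightarrow> 'k::field pol" where
  "term_pol t \<equiv> Poly_Mapping.single t 1"

abbreviation var_pol :: "nat \<Rightarrow> 'k::field pol" where
  "var_pol i \<equiv> term_pol (Poly_Mapping.single i 1)"

text \<open>\<open>tlt s t\<close> means \<open>s \<prec> t\<close>. Only the restriction of \<open>tlt\<close> to \<open>terms n\<close> matters.\<close>

definition term_order :: "nat \<Rightarrow> (trm \<Rightarrow> trm \<Rightarrow> bool) \<Rightarrow> bool" where
  "term_order n tlt \<longleftrightarrow>
     irreflp_on (terms n) tlt \<and> transp_on (terms n) tlt \<and> totalp_on (terms n) tlt \<and>
     (\<forall>t\<in>terms n. t \<noteq> 0 \<longrightarrow> tlt 0 t) \<and>
     (\<forall>s\<in>terms n. \<forall>t\<in>terms n. \<forall>u\<in>terms n. tlt s t \<longrightarrow> tlt (s + u) (t + u)) \<and>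
     (\<forall>i j. i < j \<and> j \<le> n \<longrightarrow> tlt (Poly_Mapping.single i 1) (Poly_Mapping.single j 1))"

definition greatest_wrt :: "('a \<Rightarrow> 'a \<Rightarrow> bool) \<Rightarrow> 'a set \<Rightarrow> 'a" where
  "greatest_wrt R A = (THE x. x \<in> A \<and> (\<forall>y\<in>A. y \<noteq> x \<longrightarrow> R y x))"

definition initial_term :: "(trm \<Rightarrow> trm \<Rightarrow> bool) \<Rightarrow> 'k::field pol \<Rightarrow> trm" where
  "initial_term tlt f = greatest_wrt tlt (Poly_Mapping.keys f)"

definition initial_space :: "(trm \<Rightarrow> trm \<Rightarrow> bool) \<Rightarrow> 'k::field pol set \<Rightarrow> 'k pol set" where
  "initial_space tlt V = pm.span {term_pol (initial_term tlt f) | f. f \<in> V \<and> f \<noteq> 0}"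

definition GL :: "nat \<Rightarrow> 'k::field mat set" where
  "GL n = {g \<in> carrier_mat (n + 1) (n + 1). invertible_mat g}"

text \<open>Evaluation of a polynomial at \<open>x\<close>, with coefficients mapped by \<open>h\<close>.\<close>

definition eval_pol ::
    "('k \<Rightarrow> 'r) \<Rightarrow> ('v \<Rightarrow> 'r) \<Rightarrow> (('v \<Rightarrow>\<^sub>0 nat) \<Rightarrow>\<^sub>0 'k::field) \<Rightarrow> 'r::comm_ring_1" where
  "eval_pol h x f =
     (\<Sum>t\<in>Poly_Mapping.keys f.
        h (Poly_Mapping.lookup f t) * (\<Prod>v\<in>Poly_Mapping.keys t. x v ^ Poly_Mapping.lookup t v))"

definition act :: "nat \<Rightarrow> 'k::field mat \<Rightarrow> 'k pol \<Rightarrow> 'k pol" where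
  "act n g = eval_pol (Poly_Mapping.single 0) (\<lambda>i. \<Sum>j\<le>n. pm_scale (g $$ (i, j)) (var_pol j))"

definition orbit :: "nat \<Rightarrow> 'k::field pol set \<Rightarrow> 'k pol set set" where
  "orbit n V = {act n g ` V | g. g \<in> GL n}"

text \<open>
  Zariski open subsets of \<open>GL\<close>. Since the determinant is invertible on \<open>GL\<close>, its inverse is not
  needed among the defining functions.
\<close>

definition zariski_open_GL :: "nat \<Rightarrow> 'k::field mat set \<Rightarrow> bool" where
  "zariski_open_GL n U \<longleftrightarrow>
     (\<exists>P :: ((nat \<times> nat \<Rightarrow>\<^sub>0 nat) \<Rightarrow>\<^sub>0 'k) set.
        (\<forall>p\<in>P. \<forall>t\<in>Poly_Mapping.keys p. Poly_Mapping.keys t \<subseteq> {..n} \<times> {..n}) \<and>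
        U = {g \<in> GL n. \<exists>p\<in>P. eval_pol id (\<lambda>ij. g $$ ij) p \<noteq> 0})"

definition gin_space ::
    "nat \<Rightarrow> (trm \<Rightarrow> trm \<Rightarrow> bool) \<Rightarrow> 'k::field pol set \<Rightarrow> 'k pol set" where
  "gin_space n tlt V =
     (THE W. \<exists>U. zariski_open_GL n U \<and> U \<noteq> {} \<and> (\<forall>g\<in>U. initial_space tlt (act n g ` V) = W))"

text \<open>The \<open>K\<close>-points of the Grassmannian of \<open>q\<close>-dimensional subspaces of the degree \<open>m\<close> component.\<close>

definition Gr :: "nat \<Rightarrow> nat \<Rightarrow> nat \<Rightarrow> 'k::field pol set set" where
  "Gr n m q = {V. pm.subspace V \<and> V \<subseteq> homogeneous n m \<and> pm.dim V = q}"

text \<open>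
  \<open>\<tau>\<^sub>1 \<and> \<dots> \<and> \<tau>\<^sub>q\<close> with \<open>\<tau>\<^sub>1 \<succ> \<dots> \<succ> \<tau>\<^sub>q\<close> is represented by the list \<open>[\<tau>\<^sub>1, \<dots>, \<tau>\<^sub>q]\<close>; \<open>wedge_terms\<close>
  is the corresponding element of the exterior power.
\<close>

definition TT :: "nat \<Rightarrow> nat \<Rightarrow> nat \<Rightarrow> (trm \<Rightarrow> trm \<Rightarrow> bool) \<Rightarrow> trm list set" where
  "TT n m q tlt =
     {L. length L = q \<and> set L \<subseteq> terms_deg n m \<and> sorted_wrt (\<lambda>s t. tlt t s) L}"

definition wedge_terms :: "trm list \<Rightarrow> (trm, 'k::field) ext" where
  "wedge_terms L = wedge (map term_pol L)"

definition TT_less :: "(trm \<Rightarrow> trm \<Rightarrow> bool) \<Rightarrow> trm list \<Rightarrow> trm list \<Rightarrow> bool" where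
  "TT_less tlt L M \<longleftrightarrow> (\<exists>j<length L. (\<forall>i<j. L ! i = M ! i) \<and> tlt (L ! j) (M ! j))"

definition vs :: "trm list \<Rightarrow> 'k::field pol set" where
  "vs L = pm.span (term_pol ` set L)"

definition plucker_coord ::
    "nat \<Rightarrow> nat \<Rightarrow> nat \<Rightarrow> (trm \<Rightarrow> trm \<Rightarrow> bool) \<Rightarrow> trm list \<Rightarrow> (trm, 'k::field) ext \<Rightarrow> 'k" where
  "plucker_coord n m q tlt L \<eta> =
     ext.representation (wedge_terms ` TT n m q tlt) \<eta> (wedge_terms L)"

text \<open>
  The Pluecker embedding sends \<open>V\<close> to the line \<open>ext_power q V\<close>; at a \<open>K\<close>-point a homogeneous
  coordinate is invertible iff it does not vanish on that line.
\<close>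

definition U_open ::
    "nat \<Rightarrow> nat \<Rightarrow> nat \<Rightarrow> (trm \<Rightarrow> trm \<Rightarrow> bool) \<Rightarrow> trm list \<Rightarrow> 'k::field pol set set" where
  "U_open n m q tlt L =
     {V \<in> Gr n m q. \<exists>\<eta>\<in>ext_power q V. plucker_coord n m q tlt L \<eta> \<noteq> 0}"

definition Delta_Supp ::
    "nat \<Rightarrow> nat \<Rightarrow> nat \<Rightarrow> (trm \<Rightarrow> trm \<Rightarrow> bool) \<Rightarrow> 'k::field pol set set \<Rightarrow> trm list set" where
  "Delta_Supp n m q tlt W = {L \<in> TT n m q tlt. U_open n m q tlt L \<inter> W \<noteq> {}}"

definition in_wedge ::
    "nat \<Rightarrow> nat \<Rightarrow> nat \<Rightarrow> (trm \<Rightarrow> trm \<Rightarrow> bool) \<Rightarrow> 'k::field pol set set \<Rightarrow> trm list" where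
  "in_wedge n m q tlt W = greatest_wrt (TT_less tlt) (Delta_Supp n m q tlt W)"

text \<open>For a set \<open>W\<close> of points, \<open>\<O>(W)\<close> is the union of the orbits of its elements.\<close>

definition gin_wedge ::
    "nat \<Rightarrow> nat \<Rightarrow> nat \<Rightarrow> (trm \<Rightarrow> trm \<Rightarrow> bool) \<Rightarrow> 'k::field pol set set \<Rightarrow> trm list" where
  "gin_wedge n m q tlt W =
     greatest_wrt (TT_less tlt) (Delta_Supp n m q tlt (\<Union>V\<in>W. orbit n V))"

text \<open>\<open>Borel TYPE('k) n L\<close>: the field has to be named, as \<open>L\<close> itself does not determine it.\<close>

definition Borel :: "'k::field itself \<Rightarrow> nat \<Rightarrow> trm list \<Rightarrow> bool" where
  "Borel _ n L \<longleftrightarrow>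
     (\<forall>g \<in> (GL n :: 'k mat set). upper_triangular g \<longrightarrow>
        wedge (map (\<lambda>t. act n g (term_pol t)) L) \<in> ext.span {wedge_terms L})"

end

theory Submission
  imports Defs "Jordan_Normal_Form.Determinant"
begin

text \<open>
  Pluecker coordinates are minors: the alternating multilinear form \<open>minor L\<close> factors through the
  exterior power and is dual to the basis of wedges of terms. For a basis of \<open>V\<close> whose initial
  terms \<open>\<tau>\<^sub>1 \<succ> \<dots> \<succ> \<tau>\<^sub>q\<close> are distinct, the matrix of this minor at \<open>\<tau>\<^sub>1 \<and> \<dots> \<and> \<tau>\<^sub>q\<close> is triangular, and any
  other non-zero minor is smaller; this gives the statement on \<open>in(V)\<close>. The minor at the generic
  initial wedge is a polynomial in the entries of \<open>g\<close>, whose non-vanishing locus is the open set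
  defining \<open>gin(V)\<close>. If an upper triangular \<open>g\<close> moved the line of the generic initial wedge, a larger
  wedge \<open>M\<close> would occur; composing \<open>g\<close> with a suitable torus element isolates this contribution,
  so that \<open>M\<close> would already occur in the support of the orbit.
\<close>

section \<open>Minors and the exterior power\<close>

text \<open>The obstacle in the Borel part is cancellation. Even if \<open>M\<close> occurs in
  \<open>g\<close> applied to the line of the generic initial wedge, it need not occur for
  \<open>g(W)\<close>, where \<open>W\<close> is a translate of \<open>V\<close> with that initial
  wedge: the minor of \<open>g(W)\<close> at \<open>M\<close> also collects contributions of the
  non-leading terms of a basis of \<open>W\<close>. Torus weights depending on one parameter
  \<open>x\<close> turn every contribution into a monomial in \<open>x\<close>, and the leading one
  is alone in its degree, so cancellation happens only for finitely many \<open>x\<close>. That the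
  field is infinite enters twice, both times to find a non-root of a non-zero univariate polynomial:
  on a line joining two points of GL, which makes the definite description of gin(V) unique, and on
  the one-parameter torus family. Minors are needed as functionals because wedges are classes in a
  quotient: multilinear manipulation shows that a wedge vanishes or lies in a span, but never that
  it is non-zero. The same functionals also bound the number of initial terms by
  \<open>q\<close>.\<close>

abbreviation lookup :: "('a \<Rightarrow>\<^sub>0 'b::zero) \<Rightarrow> 'a \<Rightarrow> 'b" where
  "lookup \<equiv> Poly_Mapping.lookup"

abbreviation keys :: "('a \<Rightarrow>\<^sub>0 'b::zero) \<Rightarrow> 'a set" where
  "keys \<equiv> Poly_Mapping.keys"

definition minor :: "'b list \<Rightarrow> ('b \<Rightarrow>\<^sub>0 'k::field) list \<Rightarrow> 'k" where
  "minor L zs = det (mat (length L) (length L) (\<lambda>(i, j). lookup (zs ! i) (L ! j)))"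

lemma minor_leibniz:
  "minor L zs = (\<Sum>p | p permutes {0..<length L}.
     signof p * (\<Prod>i = 0..<length L. lookup (zs ! i) (L ! p i)))"
  unfolding minor_def
  by (subst det_def'[of _ "length L"]) (auto intro!: sum.cong prod.cong)

lemma minor_cong:
  assumes "\<And>i. i < length L \<Longrightarrow> zs ! i = ws ! i"
  shows "minor L zs = minor L ws"
  unfolding minor_leibniz using assms by (auto intro!: sum.cong prod.cong)

text \<open>One summand of the Leibniz formula must survive, and it matches the columns with rows
  that contain them. Order comparisons of wedges with non-zero minors rest on this matching
  alone.\<close>

lemma minor_nonzero_permutation:
  assumes "minor L zs \<noteq> 0"
  obtains p where "p permutes {0..<length L}" "\<And>i. i < length L \<Longrightarrow> L ! p i \<in> keys (zs ! i)"
proof -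
  obtain p where "p \<in> {p. p permutes {0..<length L}}"
    "signof p * (\<Prod>i = 0..<length L. lookup (zs ! i) (L ! p i)) \<noteq> 0"
    by (rule sum.not_neutral_contains_not_neutral[OF assms[unfolded minor_leibniz]])
  then show thesis
    by (intro that[of p]) (simp_all add: in_keys_iff)
qed

text \<open>Singling out the row \<open>length us\<close> in the Leibniz formula exhibits the
  dependence on \<open>v\<close> as linear. The \<open>0\<close> is a dummy: its row is excluded
  from the remaining product, so these factors do not mention \<open>v\<close>.\<close>

lemma minor_expand:
  assumes "length us < length L"
  shows "minor L (us @ v # zs) = (\<Sum>p | p permutes {0..<length L}. signof p *
     (lookup v (L ! p (length us)) *
       (\<Prod>i \<in> {0..<length L} - {length us}. lookup ((us @ 0 # zs) ! i) (L ! p i))))"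
proof -
  have "(us @ v # zs) ! i = (us @ 0 # zs) ! i" if "i \<noteq> length us" for i
    using that by (simp add: nth_append nth_Cons')
  then show ?thesis
    unfolding minor_leibniz using assms
    by (intro sum.cong) (simp_all add: prod.remove[of _ "length us"])
qed

lemma minor_add:
  assumes "length us < length L"
  shows "minor L (us @ (v + w) # zs) = minor L (us @ v # zs) + minor L (us @ w # zs)"
  by (simp add: minor_expand[OF assms] lookup_add algebra_simps sum.distrib)

lemma minor_scale:
  assumes "length us < length L"
  shows "minor L (us @ pm_scale c v # zs) = c * minor L (us @ v # zs)"
  by (simp add: minor_expand[OF assms] lookup_add algebra_simps sum_distrib_left)

lemma minor_repeated:
  assumes "length L = length (us @ v # zs @ v # ws)"
  shows "minor L (us @ v # zs @ v # ws) = 0"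
  unfolding minor_def
  by (rule det_identical_rows[of _ "length L" "length us" "length us + Suc (length zs)"])
     (use assms in \<open>auto simp: nth_append intro!: eq_vecI\<close>)

text \<open>Linear extension of \<open>minor L\<close> to the free space on lists.
  \<open>ext_relations\<close> mixes relations of all lengths; sending lists of a length other than
  \<open>length L\<close> to 0 makes the functional vanish on every one of them.\<close>

definition list_functional :: "'b list \<Rightarrow> (('b \<Rightarrow>\<^sub>0 'k::field) list \<Rightarrow>\<^sub>0 'k) \<Rightarrow> 'k" where
  "list_functional L x =
     (\<Sum>zs\<in>keys x. lookup x zs * (if length zs = length L then minor L zs else 0))"

lemma list_functional_superset:
  assumes "finite A" "keys x \<subseteq> A"
  shows "list_functional L x =
    (\<Sum>zs\<in>A. lookup x zs * (if length zs = length L then minor L zs else 0))"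
  unfolding list_functional_def
  by (rule sum.mono_neutral_left[OF assms]) (auto simp: in_keys_iff)

lemma list_functional_add: "list_functional L (x + y) = list_functional L x + list_functional L y"
  by (subst (1 2 3) list_functional_superset[of "keys x \<union> keys y"])
     (auto simp: lookup_add algebra_simps sum.distrib dest!: set_mp[OF keys_add])

lemma list_functional_scale: "list_functional L (pm_scale c x) = c * list_functional L x"
  by (subst (1 2) list_functional_superset[of "keys x"])
     (auto simp: in_keys_iff sum_distrib_left algebra_simps)

lemma list_functional_diff: "list_functional L (x - y) = list_functional L x - list_functional L y"
  using list_functional_add[of L "x - y" y] by simp

lemma list_functional_single:
  "list_functional L (Poly_Mapping.single zs c) =
     (if length zs = length L then c * minor L zs else 0)"
  by (simp add: list_functional_def)

lemma list_functional_span_relations: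
  assumes "x \<in> pm.span ext_relations"
  shows "list_functional L x = 0"
  using assms
proof (induction rule: pm.span_induct_alt)
  case base
  show ?case by (simp add: list_functional_def)
next
  case (step c x y)
  have "list_functional L x = 0"
    using step(1) unfolding ext_relations_def
    by (auto simp: list_functional_diff list_functional_single minor_add minor_scale minor_repeated)
  with step show ?case
    by (simp add: list_functional_add list_functional_scale)
qed

text \<open>The detector of non-zero elements in the quotient: independence of the wedges of terms
  and the non-vanishing of particular wedges are read off from its values.\<close>

lift_definition ext_coord :: "'b list \<Rightarrow> ('b, 'k::field) ext \<Rightarrow> 'k" is list_functional
  using list_functional_span_relations by (fastforce simp: ext_rel_def list_functional_diff)

lemma ext_coord_add: "ext_coord L (x + y) = ext_coord L x + ext_coord L y"
  by transfer (rule list_functional_add)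

lemma ext_coord_scale: "ext_coord L (ext_scale c x) = c * ext_coord L x"
  by transfer (rule list_functional_scale)

lemma ext_coord_zero: "ext_coord L 0 = 0"
  by transfer (simp add: list_functional_def)

lemma ext_coord_sum: "ext_coord L (sum f A) = (\<Sum>a\<in>A. ext_coord L (f a))"
  by (induction A rule: infinite_finite_induct) (auto simp: ext_coord_zero ext_coord_add)

lemma ext_coord_wedge: "length zs = length L \<Longrightarrow> ext_coord L (wedge zs) = minor L zs"
  unfolding wedge_def by transfer (simp add: list_functional_single)

section \<open>Alternating multilinear calculus of wedges\<close>

lemma abs_ext_eq_iff: "abs_ext x = abs_ext y \<longleftrightarrow> x - y \<in> pm.span ext_relations"
  by (simp add: ext.abs_eq_iff ext_rel_def)

lemma wedge_add: "wedge (us @ (v + w) # zs) = wedge (us @ v # zs) + wedge (us @ w # zs)"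
  unfolding wedge_def plus_ext.abs_eq abs_ext_eq_iff diff_diff_add[symmetric]
  by (rule pm.span_base) (unfold ext_relations_def, blast)

lemma wedge_scale: "wedge (us @ pm_scale c v # zs) = ext_scale c (wedge (us @ v # zs))"
proof -
  have "pm_scale c (Poly_Mapping.single (us @ v # zs) 1) = Poly_Mapping.single (us @ v # zs) c"
    by (auto intro!: poly_mapping_eqI simp: lookup_single when_def)
  show ?thesis
    unfolding wedge_def ext_scale.abs_eq abs_ext_eq_iff \<open>pm_scale c _ = _\<close>
    by (intro pm.span_base) (unfold ext_relations_def, blast)
qed

lemma wedge_repeated: "wedge (us @ v # zs @ v # ws) = 0"
  unfolding wedge_def zero_ext_def abs_ext_eq_iff diff_zero
  by (intro pm.span_base) (unfold ext_relations_def, blast)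

lemma wedge_not_distinct: "\<not> distinct zs \<Longrightarrow> wedge zs = 0"
  using not_distinct_decomp[of zs] wedge_repeated by fastforce

lemma wedge_swap: "wedge (us @ v # w # zs) = - wedge (us @ w # v # zs)"
proof -
  \<comment> \<open>Polarization: expanding a wedge with the repeated entry \<open>v + w\<close>
    leaves only the two mixed terms.\<close>
  have "0 = wedge (us @ (v + w) # (v + w) # zs)"
    using wedge_repeated[of us "v + w" "[]" zs] by simp
  also have "\<dots> = wedge (us @ v # w # zs) + wedge (us @ w # v # zs)"
    using wedge_add[of us v w "(v + w) # zs"] wedge_add[of "us @ [v]" v w zs]
      wedge_add[of "us @ [w]" v w zs] wedge_repeated[of us v "[]" zs] wedge_repeated[of us w "[]" zs]
    by simp
  finally show ?thesis by (simp add: eq_neg_iff_add_eq_0)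
qed

text \<open>The sign is left undetermined, since only membership in subspaces is at stake and these
  are closed under negation.\<close>

lemma wedge_move: "wedge (us @ as @ x # bs) \<in> {wedge (us @ x # as @ bs), - wedge (us @ x # as @ bs)}"
proof (induction as arbitrary: us)
  case (Cons a as)
  show ?case
    using Cons[of "us @ [a]"] wedge_swap[of us a x "as @ bs"] by auto
qed simp

lemma wedge_mset_eq:
  assumes "mset zs = mset ws"
  shows "wedge (us @ zs) \<in> {wedge (us @ ws), - wedge (us @ ws)}"
  using assms
proof (induction ws arbitrary: us zs)
  case (Cons w ws)
  from Cons.prems obtain as bs where zs: "zs = as @ w # bs"
    by (metis in_set_conv_decomp list.set_intros(1) mset_eq_setD)
  with Cons.prems have "mset (as @ bs) = mset ws" by simp
  from Cons.IH[OF this, of "us @ [w]"] wedge_move[of us as w bs] zs show ?case by auto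
qed simp

text \<open>The prefix \<open>us\<close> drives the induction: once the head is expanded over
  \<open>B\<close>, the chosen \<open>b\<close> joins the prefix and the tail falls to the induction
  hypothesis.\<close>

lemma wedge_mem_span_basis_lists:
  assumes "set zs \<subseteq> pm.span B"
  shows "wedge (us @ zs) \<in> ext.span {wedge (us @ ws) | ws. length ws = length zs \<and> set ws \<subseteq> B}"
  using assms
proof (induction zs arbitrary: us)
  case Nil
  show ?case by (auto intro!: ext.span_base)
next
  case (Cons v zs)
  let ?S = "ext.span {wedge (us @ ws) | ws. length ws = length (v # zs) \<and> set ws \<subseteq> B}"
  from Cons.prems have "v \<in> pm.span B" by simp
  then show ?case
  proof (induction rule: pm.span_induct_alt)
    case base
    show ?case using wedge_scale[of us 0 0 zs] by (simp add: ext.span_zero)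
  next
    case (step c b y)
    have "{wedge ((us @ [b]) @ ws) | ws. length ws = length zs \<and> set ws \<subseteq> B}
        \<subseteq> {wedge (us @ ws) | ws. length ws = length (v # zs) \<and> set ws \<subseteq> B}"
      using step(1) by (force intro: exI[of _ "b # _"])
    then have "wedge ((us @ [b]) @ zs) \<in> ?S"
      using Cons.IH[of "us @ [b]"] Cons.prems ext.span_mono by auto blast
    with step(2) show ?case
      by (simp add: wedge_add wedge_scale ext.span_add ext.span_scale)
  qed
qed

text \<open>Lists with repetitions contribute 0 and rearrangements differ by a sign, so one
  representative per rearrangement class suffices. Three instances matter: \<open>D = {zs}\<close>
  makes the exterior power of a span a line, decreasing lists of terms give the spanning half of the
  basis statement, and \<open>D = {}\<close> kills wedges longer than a basis.\<close>

lemma wedge_mem_span_distinct: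
  assumes "set zs \<subseteq> pm.span B"
    and "\<And>ws. length ws = length zs \<Longrightarrow> set ws \<subseteq> B \<Longrightarrow> distinct ws \<Longrightarrow> \<exists>us\<in>D. mset us = mset ws"
  shows "wedge zs \<in> ext.span (wedge ` D)"
proof -
  have "wedge ws \<in> ext.span (wedge ` D)" if "length ws = length zs" "set ws \<subseteq> B" for ws
  proof (cases "distinct ws")
    case True
    with assms(2) that obtain us where "us \<in> D" "mset ws = mset us" by metis
    moreover have "wedge us \<in> ext.span (wedge ` D)"
      using \<open>us \<in> D\<close> by (intro ext.span_base) simp
    ultimately show ?thesis
      using wedge_mset_eq[of ws us "[]"] ext.span_neg by fastforce
  qed (simp add: wedge_not_distinct ext.span_zero)
  then have "ext.span {wedge ([] @ ws) | ws. length ws = length zs \<and> set ws \<subseteq> B}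
      \<subseteq> ext.span (wedge ` D)"
    by (intro ext.span_minimal) auto
  with wedge_mem_span_basis_lists[OF assms(1), of "[]"] show ?thesis by auto
qed

lemma ext_power_span:
  "ext_power (length zs) (pm.span (set zs)) = ext.span {wedge zs}"
proof
  show "ext_power (length zs) (pm.span (set zs)) \<subseteq> ext.span {wedge zs}"
    unfolding ext_power_def
  proof (intro ext.span_minimal subsetI, safe)
    fix us :: "('a \<Rightarrow>\<^sub>0 'b) list"
    assume us: "length us = length zs" "set us \<subseteq> pm.span (set zs)"
    have "wedge us \<in> ext.span (wedge ` {zs})"
    proof (rule wedge_mem_span_distinct[OF us(2)])
      fix ws :: "('a \<Rightarrow>\<^sub>0 'b) list"
      assume ws: "length ws = length us" "set ws \<subseteq> set zs" "distinct ws"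
      \<comment> \<open>A distinct list of \<open>length zs\<close> vectors from
        \<open>set zs\<close> exhausts that set, so \<open>zs\<close> is distinct as well and
        \<open>ws\<close> is a rearrangement of it.\<close>
      then have "card (set ws) = length zs" using us by (simp add: distinct_card)
      with ws have "set ws = set zs"
        by (metis List.finite_set card_length card_mono card_subset_eq le_antisym)
      with ws us have "distinct zs"
        by (metis card_distinct distinct_card)
      with \<open>set ws = set zs\<close> ws have "mset zs = mset ws"
        using set_eq_iff_mset_eq_distinct by blast
      then show "\<exists>us\<in>{zs}. mset us = mset ws" by simp
    qed
    then show "wedge us \<in> ext.span {wedge zs}" by simp
  qed
next
  show "ext.span {wedge zs} \<subseteq> ext_power (length zs) (pm.span (set zs))"
    unfolding ext_power_def by (intro ext.span_mono) (auto intro: pm.span_base)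
qed

section \<open>Term orders and initial spaces\<close>

lemma greatest_wrt_eqI:
  assumes "x \<in> A" "\<And>y. y \<in> A \<Longrightarrow> y \<noteq> x \<Longrightarrow> R y x" "asymp_on A R"
  shows "greatest_wrt R A = x"
  unfolding greatest_wrt_def using assms by (intro the_equality) (auto dest: asymp_onD)

lemma terms_deg_subset_terms: "terms_deg n m \<subseteq> terms n"
  by (auto simp: terms_deg_def)

lemma zero_in_terms: "0 \<in> terms n"
  by (simp add: terms_def)

lemma terms_add: "s \<in> terms n \<Longrightarrow> t \<in> terms n \<Longrightarrow> s + t \<in> terms n"
  using keys_add[of s t] unfolding terms_def by blast

lemma terms_sum: "(\<And>i. i \<in> A \<Longrightarrow> s i \<in> terms n) \<Longrightarrow> sum s A \<in> terms n"
  by (induction A rule: infinite_finite_induct) (auto simp: zero_in_terms terms_add)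

lemma lookup_le_of_mem_terms_deg:
  assumes "t \<in> terms_deg n m"
  shows "lookup t i \<le> m"
proof (cases "i \<in> keys t")
  case True
  then show ?thesis
    using assms member_le_sum[of i "keys t" "lookup t"] by (simp add: terms_deg_def)
qed (simp add: in_keys_iff)

lemma finite_terms_deg: "finite (terms_deg n m)"
proof (rule finite_imageD)
  have "lookup ` terms_deg n m \<subseteq> {f. \<forall>i. (i \<in> {..n} \<longrightarrow> f i \<in> {..m}) \<and> (i \<notin> {..n} \<longrightarrow> f i = 0)}"
    using lookup_le_of_mem_terms_deg
    by (force simp: terms_def in_keys_iff subset_iff dest: subsetD[OF terms_deg_subset_terms])
  then show "finite (lookup ` terms_deg n m)"
    by (rule finite_subset) (intro finite_set_of_finite_funs; simp)
qed (auto intro!: inj_onI poly_mapping_eqI)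

lemma finite_TT: "finite (TT n m q tlt)"
  by (rule finite_subset[OF _ finite_lists_length_eq[OF finite_terms_deg, of n m q]])
     (auto simp: TT_def)

lemma pm_eq_sum_terms:
  fixes f :: "'b \<Rightarrow>\<^sub>0 'k::field"
  assumes "finite A" "keys f \<subseteq> A"
  shows "f = (\<Sum>t\<in>A. pm_scale (lookup f t) (Poly_Mapping.single t 1))"
proof (rule poly_mapping_eqI)
  fix u
  have "lookup (\<Sum>t\<in>A. pm_scale (lookup f t) (Poly_Mapping.single t 1)) u
      = (\<Sum>t\<in>A. if t = u then lookup f t else 0)"
    by (simp add: lookup_sum lookup_single when_def if_distrib cong: if_cong)
  then show "lookup f u = lookup (\<Sum>t\<in>A. pm_scale (lookup f t) (Poly_Mapping.single t 1)) u"
    using assms by (auto simp: in_keys_iff subset_iff)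
qed

lemma homogeneous_subset_span: "homogeneous n m \<subseteq> pm.span (term_pol ` terms_deg n m)"
proof
  fix f :: "'k::field pol"
  assume "f \<in> homogeneous n m"
  then have "keys f \<subseteq> terms_deg n m" by (simp add: homogeneous_def)
  then have "f = (\<Sum>t\<in>terms_deg n m. pm_scale (lookup f t) (term_pol t))"
    by (rule pm_eq_sum_terms[OF finite_terms_deg])
  moreover have "\<dots> \<in> pm.span (term_pol ` terms_deg n m)"
    by (intro pm.span_sum pm.span_scale pm.span_base) auto
  ultimately show "f \<in> pm.span (term_pol ` terms_deg n m)" by simp
qed

lemma Gr_basis_subset:
  assumes "V \<in> Gr n m q" "V = pm.span (set fs)"
  shows "set fs \<subseteq> homogeneous n m"
  using assms pm.span_superset[of "set fs"] by (auto simp: Gr_def)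

locale ordered_terms =
  fixes n :: nat and tlt :: "trm \<Rightarrow> trm \<Rightarrow> bool"
  assumes term_order: "term_order n tlt"
begin

abbreviation tle :: "trm \<Rightarrow> trm \<Rightarrow> bool" where
  "tle s t \<equiv> s = t \<or> tlt s t"

lemma tlt_irrefl: "t \<in> terms n \<Longrightarrow> \<not> tlt t t"
  using term_order by (auto simp: term_order_def dest: irreflp_onD)

lemma tlt_trans: "tlt s t \<Longrightarrow> tlt t u \<Longrightarrow> s \<in> terms n \<Longrightarrow> t \<in> terms n \<Longrightarrow> u \<in> terms n \<Longrightarrow> tlt s u"
  using term_order by (auto simp: term_order_def dest: transp_onD)

lemma tlt_asym: "tlt s t \<Longrightarrow> tlt t s \<Longrightarrow> s \<in> terms n \<Longrightarrow> t \<in> terms n \<Longrightarrow> False"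
  using tlt_irrefl tlt_trans by blast

lemma tlt_total: "s \<in> terms n \<Longrightarrow> t \<in> terms n \<Longrightarrow> s \<noteq> t \<Longrightarrow> tlt s t \<or> tlt t s"
  using term_order by (auto simp: term_order_def dest: totalp_onD)

lemma asymp_on_tlt: "A \<subseteq> terms n \<Longrightarrow> asymp_on A tlt"
  using tlt_asym by (auto intro!: asymp_onI)

lemma tlt_add:
  "tlt s t \<Longrightarrow> s \<in> terms n \<Longrightarrow> t \<in> terms n \<Longrightarrow> u \<in> terms n \<Longrightarrow> tlt (s + u) (t + u)"
  using term_order by (auto simp: term_order_def)

text \<open>Both parts pass through \<open>s' + t\<close>. Each of the two steps is monotone, so
  equal end points force both to be equalities. Extended to finite sums, this rigidity later
  separates the leading terms from all other choices with the same product.\<close>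

lemma tle_add:
  assumes "tle s s'" "tle t t'" "s \<in> terms n" "s' \<in> terms n" "t \<in> terms n" "t' \<in> terms n"
  shows "tle (s + t) (s' + t')" "s + t = s' + t' \<longleftrightarrow> s = s' \<and> t = t'"
proof -
  have 1: "tle (s + t) (s' + t)" using assms tlt_add by blast
  have 2: "tle (s' + t) (s' + t')" using assms tlt_add[of t t' s'] by (auto simp: add.commute)
  show "tle (s + t) (s' + t')"
    using 1 2 tlt_trans[of "s + t" "s' + t" "s' + t'"] assms terms_add by auto
  show "s + t = s' + t' \<longleftrightarrow> s = s' \<and> t = t'"
    using 1 2 tlt_asym[of "s + t" "s' + t"] assms terms_add by auto
qed

lemma tle_sum:
  assumes "finite A" "\<And>i. i \<in> A \<Longrightarrow> s i \<in> terms n" "\<And>i. i \<in> A \<Longrightarrow> t i \<in> terms n"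
    and "\<And>i. i \<in> A \<Longrightarrow> tle (s i) (t i)"
  shows "tle (sum s A) (sum t A) \<and> (sum s A = sum t A \<longrightarrow> (\<forall>i\<in>A. s i = t i))"
  using assms
proof (induction A rule: finite_induct)
  case (insert x A)
  then have "sum s A \<in> terms n" "sum t A \<in> terms n" by (auto intro: terms_sum)
  with insert tle_add[of "s x" "t x" "sum s A" "sum t A"] show ?case by auto
qed simp

lemma greatest_term:
  assumes "finite A" "A \<subseteq> terms n" "A \<noteq> {}"
  obtains t where "t \<in> A" "\<And>s. s \<in> A \<Longrightarrow> s \<noteq> t \<Longrightarrow> tlt s t"
proof -
  have "transp_on A tlt" "totalp_on A tlt"
    using assms(2) term_order unfolding term_order_def
    by (auto intro: transp_on_subset totalp_on_subset)
  with assms show thesis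
    using Finite_Set.bex_greatest_element[OF assms(1,3)] that by blast
qed

lemma initial_term:
  assumes "f \<noteq> 0" "keys f \<subseteq> terms n"
  shows "initial_term tlt f \<in> keys f" "\<And>t. t \<in> keys f \<Longrightarrow> tle t (initial_term tlt f)"
proof -
  obtain t where t: "t \<in> keys f" "\<And>s. s \<in> keys f \<Longrightarrow> s \<noteq> t \<Longrightarrow> tlt s t"
    using greatest_term[of "keys f"] assms by auto
  then have "initial_term tlt f = t"
    unfolding initial_term_def using assms by (intro greatest_wrt_eqI asymp_on_tlt) auto
  with t show "initial_term tlt f \<in> keys f" "\<And>t. t \<in> keys f \<Longrightarrow> tle t (initial_term tlt f)"
    by auto
qed

text \<open>\<open>tlt\<close> is a parameter and an order only on \<open>terms n\<close>; the
  decreasing list is obtained by repeatedly splitting off the greatest term.\<close>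

lemma sorted_list_of_terms:
  assumes "finite A" "A \<subseteq> terms n"
  shows "\<exists>L. set L = A \<and> sorted_wrt (\<lambda>s t. tlt t s) L \<and> distinct L"
  using assms
proof (induction "card A" arbitrary: A)
  case (Suc k)
  then have "A \<noteq> {}" by auto
  then obtain t where t: "t \<in> A" "\<And>s. s \<in> A \<Longrightarrow> s \<noteq> t \<Longrightarrow> tlt s t"
    using greatest_term[of A] Suc by blast
  with Suc have "\<exists>L. set L = A - {t} \<and> sorted_wrt (\<lambda>s t. tlt t s) L \<and> distinct L"
    by (intro Suc(1)) auto
  then obtain L where "set L = A - {t}" "sorted_wrt (\<lambda>s t. tlt t s) L" "distinct L" by blast
  with t show ?case by (intro exI[of _ "t # L"]) auto
qed simp

section \<open>The lexicographic order on wedges of terms\<close>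

lemma TT_D:
  assumes "L \<in> TT n m q tlt"
  shows "length L = q" "\<And>i. i < q \<Longrightarrow> L ! i \<in> terms n"
    "\<And>i. i < q \<Longrightarrow> L ! i \<in> terms_deg n m"
    "\<And>i j. i < j \<Longrightarrow> j < q \<Longrightarrow> tlt (L ! j) (L ! i)"
  using assms terms_deg_subset_terms[of n m]
  by (auto simp: TT_def sorted_wrt_iff_nth_less subset_iff)

lemma TT_less_trans:
  assumes "TT_less tlt L M" "TT_less tlt M N"
    and "L \<in> TT n m q tlt" "M \<in> TT n m q tlt" "N \<in> TT n m q tlt"
  shows "TT_less tlt L N"
proof -
  obtain i where i: "i < q" "\<And>k. k < i \<Longrightarrow> L ! k = M ! k" "tlt (L ! i) (M ! i)"
    using assms TT_D(1) by (auto simp: TT_less_def)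
  obtain j where j: "j < q" "\<And>k. k < j \<Longrightarrow> M ! k = N ! k" "tlt (M ! j) (N ! j)"
    using assms TT_D(1) by (auto simp: TT_less_def)
  have "tlt (L ! min i j) (N ! min i j)"
    using i j assms TT_D(2) tlt_trans by (cases i j rule: linorder_cases) (auto simp: min_def)
  with i j assms show ?thesis
    unfolding TT_less_def by (intro exI[of _ "min i j"]) (auto simp: TT_D(1))
qed

lemma TT_less_irrefl: "L \<in> TT n m q tlt \<Longrightarrow> \<not> TT_less tlt L L"
  using TT_D tlt_irrefl by (auto simp: TT_less_def)

lemma asymp_on_TT_less: "A \<subseteq> TT n m q tlt \<Longrightarrow> asymp_on A (TT_less tlt)"
  using TT_less_trans TT_less_irrefl by (blast intro!: asymp_onI)

lemma TT_first_difference: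
  assumes "L \<in> TT n m q tlt" "M \<in> TT n m q tlt" "L \<noteq> M"
  obtains j where "j < q" "\<And>i. i < j \<Longrightarrow> L ! i = M ! i" "L ! j \<noteq> M ! j"
proof -
  define j where "j = (LEAST j. j < q \<and> L ! j \<noteq> M ! j)"
  have "\<exists>j. j < q \<and> L ! j \<noteq> M ! j"
    using assms TT_D(1) nth_equalityI by metis
  then have "j < q \<and> L ! j \<noteq> M ! j" unfolding j_def by (rule LeastI_ex)
  moreover have "L ! i = M ! i" if "i < j" for i
    using not_less_Least[of i "\<lambda>j. j < q \<and> L ! j \<noteq> M ! j"] that calculation by (auto simp: j_def)
  ultimately show thesis using that by blast
qed

lemma TT_less_total:
  assumes "L \<in> TT n m q tlt" "M \<in> TT n m q tlt" "L \<noteq> M"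
  shows "TT_less tlt L M \<or> TT_less tlt M L"
proof -
  obtain j where "j < q" "\<And>i. i < j \<Longrightarrow> L ! i = M ! i" "L ! j \<noteq> M ! j"
    using TT_first_difference assms by blast
  with tlt_total[of "L ! j" "M ! j"] assms show ?thesis
    by (auto simp: TT_less_def TT_D intro!: exI[of _ j])
qed

lemma greatest_TT:
  assumes "A \<subseteq> TT n m q tlt" "A \<noteq> {}"
  obtains L where "L \<in> A" "\<And>M. M \<in> A \<Longrightarrow> M \<noteq> L \<Longrightarrow> TT_less tlt M L"
proof -
  have "transp_on A (TT_less tlt)" "totalp_on A (TT_less tlt)"
    using assms(1) TT_less_trans TT_less_total by (blast intro!: transp_onI totalp_onI)+
  with assms show thesis
    using Finite_Set.bex_greatest_element[OF finite_subset[OF assms(1) finite_TT] assms(2)] that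
    by blast
qed

text \<open>If \<open>j\<close> were the first difference and \<open>L ! j\<close> the larger term, then \<open>p\<close> would map
  \<open>{j..<q}\<close> injectively into \<open>{Suc j..<q}\<close>.\<close>

lemma TT_le_of_permutation:
  assumes L: "L \<in> TT n m q tlt" and M: "M \<in> TT n m q tlt"
    and p: "p permutes {0..<q}" and le: "\<And>i. i < q \<Longrightarrow> tle (L ! p i) (M ! i)"
  shows "L = M \<or> TT_less tlt L M"
proof (rule ccontr)
  assume contr: "\<not> (L = M \<or> TT_less tlt L M)"
  then obtain j where j: "j < q" "\<And>i. i < j \<Longrightarrow> L ! i = M ! i" "L ! j \<noteq> M ! j"
    using TT_first_difference L M by blast
  then have "\<not> tlt (L ! j) (M ! j)"
    using contr L by (auto simp: TT_less_def TT_D(1))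
  then have gt: "tlt (M ! j) (L ! j)"
    using tlt_total[of "L ! j" "M ! j"] j TT_D(2)[OF L] TT_D(2)[OF M] by auto
  have "p ` {j..<q} \<subseteq> {Suc j..<q}"
  proof safe
    fix i assume i: "i \<in> {j..<q}"
    then have pi: "p i < q" using permutes_in_image[OF p, of i] by auto
    have "tle (M ! i) (M ! j)" using i TT_D(4)[OF M, of j i] by (cases "i = j") auto
    then have "tlt (M ! i) (L ! j)"
      using gt i j(1) tlt_trans[OF _ gt] TT_D(2)[OF L] TT_D(2)[OF M] by auto
    then have lt: "tlt (L ! p i) (L ! j)"
      using le[of i] i pi j(1) tlt_trans[of "L ! p i" "M ! i"] TT_D(2)[OF L] TT_D(2)[OF M] by auto
    have "\<not> p i \<le> j"
    proof
      assume "p i \<le> j"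
      then have "tle (L ! j) (L ! p i)" using TT_D(4)[OF L, of "p i" j] j by (cases "p i = j") auto
      with lt show False
        using tlt_asym[OF lt] tlt_irrefl[of "L ! j"] TT_D(2)[OF L] pi j(1) by auto
    qed
    with pi show "p i \<in> {Suc j..<q}" by auto
  qed
  moreover have "card (p ` {j..<q}) = card {j..<q}"
    using permutes_inj_on[OF p] by (rule card_image)
  ultimately show False
    using card_mono[of "{Suc j..<q}" "p ` {j..<q}"] j(1) by simp
qed

lemma TT_le_of_permutation':
  assumes L: "L \<in> TT n m q tlt" and M: "M \<in> TT n m q tlt"
    and p: "p permutes {0..<q}" and le: "\<And>i. i < q \<Longrightarrow> tle (L ! i) (M ! p i)"
  shows "L = M \<or> TT_less tlt L M"
proof (rule TT_le_of_permutation[OF L M permutes_inv[OF p]])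
  fix i assume "i < q"
  then have "Hilbert_Choice.inv p i < q"
    using permutes_in_image[OF permutes_inv[OF p], of i] by auto
  from le[OF this] show "tle (L ! Hilbert_Choice.inv p i) (M ! i)"
    using permutes_inverses(1)[OF p] by simp
qed

section \<open>Minors and leading terms; the basis of wedges of terms\<close>

lemma minor_leading:
  assumes L: "L \<in> TT n m q tlt"
    and le: "\<And>i t. i < q \<Longrightarrow> t \<in> keys (hs ! i) \<Longrightarrow> tle t (L ! i)"
  shows "minor L hs = (\<Prod>i<q. lookup (hs ! i) (L ! i))"
proof -
  define A where "A = mat q q (\<lambda>(i, j). lookup (hs ! i) (L ! j))"
  have "lookup (hs ! i) (L ! j) = 0" if "i < q" "j < i" for i j
  proof (rule ccontr)
    assume "lookup (hs ! i) (L ! j) \<noteq> 0"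
    then have "tle (L ! j) (L ! i)" using le[OF \<open>i < q\<close>] by (simp add: in_keys_iff)
    moreover have "tlt (L ! i) (L ! j)" using TT_D(4)[OF L] that by blast
    ultimately show False
      using tlt_asym[of "L ! i" "L ! j"] tlt_irrefl[of "L ! i"] TT_D(2)[OF L] that by auto
  qed
  then have "upper_triangular A" by (auto simp: A_def upper_triangular_def)
  then have "det A = prod_list (diag_mat A)"
    by (rule det_upper_triangular[of _ q]) (simp add: A_def)
  also have "\<dots> = (\<Prod>i<q. lookup (hs ! i) (L ! i))"
    by (auto simp: A_def diag_mat_def interv_sum_list_conv_sum_set_nat prod.distinct_set_conv_list
        lessThan_atLeast0 simp flip: prod.distinct_set_conv_list intro!: prod.cong)
  finally show ?thesis
    using L by (simp add: minor_def A_def TT_D(1))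
qed

lemma minor_nonzero_le:
  assumes L: "L \<in> TT n m q tlt" and M: "M \<in> TT n m q tlt" and "minor M hs \<noteq> 0"
    and le: "\<And>i t. i < q \<Longrightarrow> t \<in> keys (hs ! i) \<Longrightarrow> tle t (L ! i)"
  shows "M = L \<or> TT_less tlt M L"
proof -
  obtain p where "p permutes {0..<length M}" "\<And>i. i < length M \<Longrightarrow> M ! p i \<in> keys (hs ! i)"
    using minor_nonzero_permutation[OF assms(3)] by blast
  then show ?thesis
    using TT_le_of_permutation[OF M L] le M by (auto simp: TT_D(1))
qed

text \<open>Mirror image of the upper bound. It serves the images of terms under upper triangular
  matrices, whose keys are bounded from below.\<close>

lemma minor_nonzero_ge:
  assumes L: "L \<in> TT n m q tlt" and M: "M \<in> TT n m q tlt" and "minor M hs \<noteq> 0"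
    and ge: "\<And>i t. i < q \<Longrightarrow> t \<in> keys (hs ! i) \<Longrightarrow> tle (L ! i) t"
  shows "L = M \<or> TT_less tlt L M"
proof -
  obtain p where "p permutes {0..<length M}" "\<And>i. i < length M \<Longrightarrow> M ! p i \<in> keys (hs ! i)"
    using minor_nonzero_permutation[OF assms(3)] by blast
  then show ?thesis
    using TT_le_of_permutation'[OF L M] ge M by (auto simp: TT_D(1))
qed

text \<open>The only key of a row is both its greatest and its least, so the upper and the lower
  bound apply together, and asymmetry leaves \<open>L = M\<close>.\<close>

lemma minor_term_pols:
  assumes L: "L \<in> TT n m q tlt" and M: "M \<in> TT n m q tlt"
  shows "minor L (map term_pol M) = (if L = M then 1 else (0::'k::field))"
proof -
  have "minor L (map term_pol L) = (1::'k)"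
    using L by (subst minor_leading[OF L]) (auto simp: TT_D(1))
  moreover have "L = M" if nz: "minor L (map term_pol M) \<noteq> (0::'k)"
  proof -
    have "L = M \<or> TT_less tlt L M"
      by (rule minor_nonzero_le[OF M L nz]) (use M in \<open>auto simp: TT_D(1)\<close>)
    moreover have "M = L \<or> TT_less tlt M L"
      by (rule minor_nonzero_ge[OF M L nz]) (use M in \<open>auto simp: TT_D(1)\<close>)
    ultimately show ?thesis
      using asymp_onD[OF asymp_on_TT_less[OF subset_refl]] L M by blast
  qed
  ultimately show ?thesis by auto
qed

lemma ext_coord_wedge_terms:
  assumes "L \<in> TT n m q tlt" "M \<in> TT n m q tlt"
  shows "ext_coord L (wedge_terms M) = (if L = M then 1 else (0::'k::field))"
  using assms by (simp add: wedge_terms_def ext_coord_wedge TT_D(1) minor_term_pols)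

lemma inj_on_wedge_terms:
  "inj_on (wedge_terms :: trm list \<Rightarrow> (trm, 'k::field) ext) (TT n m q tlt)"
  using ext_coord_wedge_terms[where 'k = 'k] by (intro inj_onI) (metis zero_neq_one)

lemma independent_wedge_terms:
  "ext.independent (wedge_terms ` TT n m q tlt :: (trm, 'k::field) ext set)"
proof
  assume "ext.dependent (wedge_terms ` TT n m q tlt :: (trm, 'k::field) ext set)"
  then obtain u :: "(trm, 'k) ext \<Rightarrow> 'k" and L where u: "L \<in> TT n m q tlt" "u (wedge_terms L) \<noteq> 0"
      "(\<Sum>v\<in>wedge_terms ` TT n m q tlt. ext_scale (u v) v) = 0"
    by (auto simp: ext.dependent_finite finite_TT)
  have "0 = ext_coord L (\<Sum>v\<in>wedge_terms ` TT n m q tlt. ext_scale (u v) v)"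
    by (simp add: u(3) ext_coord_zero)
  also have "\<dots> = (\<Sum>M\<in>TT n m q tlt. if M = L then u (wedge_terms M) else 0)"
    unfolding sum.reindex[OF inj_on_wedge_terms] ext_coord_sum
    using u(1) by (intro sum.cong) (auto simp: ext_coord_scale ext_coord_wedge_terms)
  also have "\<dots> = u (wedge_terms L)" using u(1) by (simp add: finite_TT)
  finally show False using u(2) by simp
qed

text \<open>The span hypothesis matters: \<open>representation\<close> is 0 off the span, whereas
  \<open>ext_coord\<close> need not vanish there.\<close>

lemma plucker_coord_eq:
  assumes "\<eta> \<in> ext.span (wedge_terms ` TT n m q tlt)" and L: "L \<in> TT n m q tlt"
  shows "plucker_coord n m q tlt L \<eta> = ext_coord L (\<eta> :: (trm, 'k::field) ext)"
proof -
  let ?B = "wedge_terms ` TT n m q tlt :: (trm, 'k) ext set"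
  have "\<eta> = (\<Sum>b\<in>?B. ext_scale (ext.representation ?B \<eta> b) b)"
    using assms(1) by (simp add: ext.sum_representation_eq independent_wedge_terms finite_TT)
  then have "ext_coord L \<eta> = ext_coord L (\<Sum>b\<in>?B. ext_scale (ext.representation ?B \<eta> b) b)"
    by (rule arg_cong)
  also have "\<dots> = (\<Sum>M\<in>TT n m q tlt. if M = L then ext.representation ?B \<eta> (wedge_terms M) else 0)"
    unfolding sum.reindex[OF inj_on_wedge_terms] ext_coord_sum
    using L by (intro sum.cong) (auto simp: ext_coord_scale ext_coord_wedge_terms)
  also have "\<dots> = plucker_coord n m q tlt L \<eta>"
    using L by (simp add: finite_TT plucker_coord_def)
  finally show ?thesis ..
qed

lemma wedge_mem_span_wedge_terms:
  assumes "set fs \<subseteq> homogeneous n m"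
  shows "wedge fs \<in> ext.span (wedge_terms ` TT n m (length fs) tlt :: (trm, 'k::field) ext set)"
proof -
  have "wedge fs \<in> ext.span (wedge ` (map term_pol ` TT n m (length fs) tlt))"
  proof (rule wedge_mem_span_distinct)
    show "set fs \<subseteq> pm.span (term_pol ` terms_deg n m)"
      using assms homogeneous_subset_span by blast
    fix ws :: "'k pol list"
    assume ws: "length ws = length fs" "set ws \<subseteq> term_pol ` terms_deg n m" "distinct ws"
    then have "ws \<in> map term_pol ` lists (terms_deg n m)"
      unfolding lists_image[symmetric] by blast
    then obtain us where us: "ws = map term_pol us" "set us \<subseteq> terms_deg n m" by auto
    with ws have "distinct us" by (simp add: distinct_map)
    obtain L where L: "set L = set us" "sorted_wrt (\<lambda>s t. tlt t s) L" "distinct L"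
      using sorted_list_of_terms[of "set us"] us(2) terms_deg_subset_terms by blast
    with \<open>distinct us\<close> have "mset L = mset us" by (simp add: set_eq_iff_mset_eq_distinct)
    moreover from this have "length L = length us" by (rule mset_eq_length)
    ultimately show "\<exists>zs\<in>map term_pol ` TT n m (length fs) tlt. mset zs = mset ws"
      using L us ws by (auto simp: TT_def intro!: exI[of _ L])
  qed
  then show ?thesis by (simp add: image_image wedge_terms_def[abs_def])
qed

lemma wedge_eq_sum_minors:
  assumes "set fs \<subseteq> homogeneous n m"
  shows "wedge fs = (\<Sum>L\<in>TT n m (length fs) tlt. ext_scale (minor L fs) (wedge_terms L)
    :: (trm, 'k::field) ext)"
proof -
  let ?B = "wedge_terms ` TT n m (length fs) tlt :: (trm, 'k) ext set"
  have "wedge fs = (\<Sum>b\<in>?B. ext_scale (ext.representation ?B (wedge fs) b) b)"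
    using wedge_mem_span_wedge_terms[OF assms]
    by (simp add: ext.sum_representation_eq independent_wedge_terms finite_TT)
  also have "\<dots> = (\<Sum>L\<in>TT n m (length fs) tlt. ext_scale (minor L fs) (wedge_terms L))"
    unfolding sum.reindex[OF inj_on_wedge_terms]
    using plucker_coord_eq[OF wedge_mem_span_wedge_terms[OF assms]]
    by (intro sum.cong) (auto simp: plucker_coord_def ext_coord_wedge TT_D(1))
  finally show ?thesis .
qed

section \<open>Pluecker charts, echelon bases and initial wedges\<close>

lemma mem_U_open_iff:
  assumes V: "V \<in> Gr n m q" "V = pm.span (set fs)" "length fs = q" and L: "L \<in> TT n m q tlt"
  shows "V \<in> U_open n m q tlt L \<longleftrightarrow> minor L fs \<noteq> 0"
proof -
  have "plucker_coord n m q tlt L (ext_scale c (wedge fs)) = c * minor L fs" for c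
    using wedge_mem_span_wedge_terms[OF Gr_basis_subset[OF V(1,2)]] V(3) L
    by (subst plucker_coord_eq) (auto simp: ext.span_scale ext_coord_scale ext_coord_wedge TT_D(1))
  \<comment> \<open>On this line the existential in \<open>U_open\<close> is decided by the single
    vector \<open>wedge fs\<close>.\<close>
  moreover have "ext_power q V = range (\<lambda>c. ext_scale c (wedge fs))"
    using ext_power_span[of fs] V by (simp add: ext.span_singleton)
  ultimately show ?thesis
    using V(1) by (auto simp: U_open_def intro: exI[of _ 1])
qed

text \<open>One vector \<open>h t\<close> is chosen for each initial term \<open>t\<close>. Division
  by leading terms shows that these vectors span \<open>V\<close>, and their leading minor shows
  that there are at most \<open>q\<close> of them. That \<open>set L\<close> consists of the initial
  terms of all of \<open>V\<close>, not only of those of \<open>hs\<close>, is what yields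
  \<open>initial_space\<close>.\<close>

lemma echelon_basis:
  assumes V: "V \<in> Gr n m q" and "q > 0"
  obtains L hs where "L \<in> TT n m q tlt" "length hs = q" "V = pm.span (set hs)"
    "set L = {initial_term tlt f | f. f \<in> V \<and> f \<noteq> 0}"
    "\<And>i. i < q \<Longrightarrow> lookup (hs ! i) (L ! i) \<noteq> 0"
    "\<And>i t. i < q \<Longrightarrow> t \<in> keys (hs ! i) \<Longrightarrow> tle t (L ! i)"
proof -
  define I where "I = {initial_term tlt f | f. f \<in> V \<and> f \<noteq> 0}"
  have sub: "pm.subspace V" and dim: "pm.dim V = q"
    and keys_V: "\<And>f. f \<in> V \<Longrightarrow> keys f \<subseteq> terms_deg n m"
    using V by (auto simp: Gr_def homogeneous_def)
  note init = initial_term[OF _ subset_trans[OF keys_V terms_deg_subset_terms]]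
  have I: "I \<subseteq> terms_deg n m"
    using init(1) keys_V unfolding I_def by blast
  then have "finite I" using finite_terms_deg finite_subset by blast
  have "\<exists>f. f \<in> V \<and> f \<noteq> 0 \<and> initial_term tlt f = t" if "t \<in> I" for t
    using that by (auto simp: I_def)
  then obtain h where h: "\<And>t. t \<in> I \<Longrightarrow> h t \<in> V \<and> h t \<noteq> 0 \<and> initial_term tlt (h t) = t"
    by metis
  have h_keys: "tle s t" if "t \<in> I" "s \<in> keys (h t)" for s t
    using init(2)[of "h t" s] h[OF that(1)] that(2) by auto
  have h_lead: "lookup (h t) t \<noteq> 0" if "t \<in> I" for t
    using init(1)[of "h t"] h[OF that] by (auto simp: in_keys_iff)
  obtain L where L: "set L = I" "sorted_wrt (\<lambda>s t. tlt t s) L" "distinct L"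
    using sorted_list_of_terms[OF \<open>finite I\<close>] I terms_deg_subset_terms by blast
  \<comment> \<open>The number of initial terms is not yet known to be \<open>q\<close>, hence
    \<open>length L\<close> in its place.\<close>
  have L_TT: "L \<in> TT n m (length L) tlt" using L I by (simp add: TT_def)
  define hs where "hs = map h L"
  have hs_lead: "lookup (hs ! i) (L ! i) \<noteq> 0" if "i < length L" for i
    using that h_lead L by (auto simp: hs_def)
  have hs_keys: "tle t (L ! i)" if "i < length L" "t \<in> keys (hs ! i)" for i t
  proof -
    have "L ! i \<in> I" "t \<in> keys (h (L ! i))" using that L(1) by (auto simp: hs_def)
    then show ?thesis by (rule h_keys)
  qed
  have "V \<subseteq> pm.span (h ` I)"
  proof
    fix f assume "f \<in> V"
    then show "f \<in> pm.span (h ` I)"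
    \<comment> \<open>The measure counts the terms of degree \<open>m\<close> bounded by some term
      of \<open>f\<close>; cancelling the leading term removes at least that term from the
      count.\<close>
    proof (induction "card {t \<in> terms_deg n m. \<exists>s\<in>keys f. tle t s}" arbitrary: f rule: less_induct)
      case less
      show ?case
      proof (cases "f = 0")
        case False
        define t where "t = initial_term tlt f"
        \<comment> \<open>The quotient of leading coefficients cancels \<open>t\<close>, and
          everything that remains is smaller.\<close>
        define g where "g = f - pm_scale (lookup f t / lookup (h t) t) (h t)"
        have t: "t \<in> I" "t \<in> keys f" "\<And>s. s \<in> keys f \<Longrightarrow> tle s t"
          using less.prems False init by (auto simp: t_def I_def)
        have "g \<in> V"
          using less.prems h[OF t(1)] sub by (simp add: g_def pm.subspace_diff pm.subspace_scale)
        have g_keys: "tlt s t" if "s \<in> keys g" for s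
        proof -
          have "s \<in> keys f \<or> s \<in> keys (h t)"
            using that by (auto simp: g_def in_keys_iff lookup_minus)
          moreover have "s \<noteq> t"
            using that h_lead[OF t(1)] by (auto simp: g_def in_keys_iff lookup_minus)
          ultimately show ?thesis using t h_keys by blast
        qed
        have "{s \<in> terms_deg n m. \<exists>u\<in>keys g. tle s u} \<subset> {s \<in> terms_deg n m. \<exists>u\<in>keys f. tle s u}"
        proof (intro psubsetI)
          have "tlt s t" if "s \<in> terms_deg n m" "u \<in> keys g" "tle s u" for s u
            using that g_keys tlt_trans keys_V[OF \<open>g \<in> V\<close>] keys_V[OF less.prems] t(2)
              terms_deg_subset_terms by blast
          then show "{s \<in> terms_deg n m. \<exists>u\<in>keys g. tle s u}
              \<subseteq> {s \<in> terms_deg n m. \<exists>u\<in>keys f. tle s u}"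
            and "{s \<in> terms_deg n m. \<exists>u\<in>keys g. tle s u}
              \<noteq> {s \<in> terms_deg n m. \<exists>u\<in>keys f. tle s u}"
            using t(2) tlt_irrefl keys_V[OF less.prems] terms_deg_subset_terms by blast+
        qed
        then have "g \<in> pm.span (h ` I)"
          using less.hyps[of g] \<open>g \<in> V\<close> finite_terms_deg by (simp add: psubset_card_mono)
        moreover have "h t \<in> pm.span (h ` I)"
          using t(1) by (intro pm.span_base) auto
        ultimately have "g + pm_scale (lookup f t / lookup (h t) t) (h t) \<in> pm.span (h ` I)"
          by (intro pm.span_add pm.span_scale)
        then show ?thesis by (simp add: g_def)
      qed (simp add: pm.span_zero)
    qed
  qed
  moreover have "pm.span (h ` I) \<subseteq> V" using h sub by (intro pm.span_minimal) auto
  ultimately have V_eq: "V = pm.span (set hs)" by (simp add: hs_def L(1))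
  have len: "length L = q"
  proof (rule antisym)
    have "q \<le> card (set hs)"
      using pm.dim_le_card[of V "set hs"] V_eq dim by simp
    then show "q \<le> length L" using card_length[of hs] by (simp add: hs_def)
    show "length L \<le> q"
    proof (rule ccontr)
      \<comment> \<open>If \<open>hs\<close> were longer than a basis \<open>B\<close>, its
        expansion over \<open>B\<close> would have a repetition in every summand, so
        \<open>wedge hs\<close> would be 0, against the non-zero triangular minor.\<close>
      assume "\<not> length L \<le> q"
      obtain B where B: "B \<subseteq> V" "V \<subseteq> pm.span B" "card B = q"
        using pm.basis_exists[of V] dim by metis
      \<comment> \<open>An infinite \<open>B\<close> would have \<open>card B = 0\<close>, which
        \<open>q > 0\<close> excludes.\<close>
      then have "finite B" using \<open>q > 0\<close> card_ge_0_finite by blast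
      have "length ws \<noteq> length hs" if "set ws \<subseteq> B" "distinct ws" for ws
        using that B(3) \<open>\<not> length L \<le> q\<close> card_mono[OF \<open>finite B\<close> that(1)]
        by (simp add: distinct_card hs_def)
      then have "wedge hs \<in> ext.span (wedge ` {})"
        using B(2) h L(1) by (intro wedge_mem_span_distinct[of _ B]) (auto simp: hs_def)
      then have "ext_coord L (wedge hs) = 0" by (simp add: ext_coord_zero)
      moreover have "minor L hs \<noteq> 0"
        using hs_lead by (simp add: minor_leading[OF L_TT hs_keys])
      ultimately show False by (simp add: ext_coord_wedge hs_def)
    qed
  qed
  show thesis
    using L_TT len L(1) V_eq hs_lead hs_keys by (intro that[of L hs]) (auto simp: I_def hs_def)
qed

lemma asymp_on_Delta_Supp: "asymp_on (Delta_Supp n m q tlt W) (TT_less tlt)"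
  by (rule asymp_on_TT_less) (auto simp: Delta_Supp_def)

lemma Delta_Supp_singleton:
  assumes "V \<in> Gr n m q" "V = pm.span (set fs)" "length fs = q"
  shows "Delta_Supp n m q tlt {V} = {L \<in> TT n m q tlt. minor L fs \<noteq> 0}"
  using mem_U_open_iff[OF assms] by (auto simp: Delta_Supp_def)

text \<open>Since any echelon basis will do, its leading list is determined by \<open>V\<close>. The
  Borel argument uses this to identify the leading list of a basis chosen later.\<close>

lemma in_wedge_echelon:
  assumes V: "V \<in> Gr n m q" "V = pm.span (set hs)" "length hs = q" and L: "L \<in> TT n m q tlt"
    and lead: "\<And>i. i < q \<Longrightarrow> lookup (hs ! i) (L ! i) \<noteq> 0"
    and le: "\<And>i t. i < q \<Longrightarrow> t \<in> keys (hs ! i) \<Longrightarrow> tle t (L ! i)"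
  shows "in_wedge n m q tlt {V} = L" "L \<in> Delta_Supp n m q tlt {V}"
proof -
  have "minor L hs \<noteq> 0" using lead by (simp add: minor_leading[OF L le])
  then show mem: "L \<in> Delta_Supp n m q tlt {V}" using L by (simp add: Delta_Supp_singleton[OF V])
  show "in_wedge n m q tlt {V} = L"
    unfolding in_wedge_def
  proof (intro greatest_wrt_eqI asymp_on_Delta_Supp mem)
    fix M assume "M \<in> Delta_Supp n m q tlt {V}" "M \<noteq> L"
    then show "TT_less tlt M L"
      using minor_nonzero_le[OF L _ _ le] by (auto simp: Delta_Supp_singleton[OF V])
  qed
qed

lemma initial_space_eq_vs:
  fixes V :: "'k::field pol set"
  assumes "V \<in> Gr n m q" "q > 0"
  shows "initial_space tlt V = vs (in_wedge n m q tlt {V})"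
    and "in_wedge n m q tlt {V} \<in> Delta_Supp n m q tlt {V}"
proof -
  obtain L hs where L: "L \<in> TT n m q tlt" "length hs = q" "V = pm.span (set hs)"
    "set L = {initial_term tlt f | f. f \<in> V \<and> f \<noteq> 0}"
    "\<And>i. i < q \<Longrightarrow> lookup (hs ! i) (L ! i) \<noteq> 0"
    "\<And>i t. i < q \<Longrightarrow> t \<in> keys (hs ! i) \<Longrightarrow> tle t (L ! i)"
    using echelon_basis[OF assms] by blast
  note in_L = in_wedge_echelon[OF assms(1) L(3,2,1,5,6)]
  have "{term_pol (initial_term tlt f) | f. f \<in> V \<and> f \<noteq> 0} = (term_pol ` set L :: 'k pol set)"
    unfolding L(4) by blast
  then show "initial_space tlt V = vs (in_wedge n m q tlt {V})"
    by (simp add: initial_space_def vs_def in_L(1))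
  show "in_wedge n m q tlt {V} \<in> Delta_Supp n m q tlt {V}" using in_L by simp
qed

lemma ext_power_vs: "length L = q \<Longrightarrow> ext_power q (vs L) = ext.span {wedge_terms L}"
  using ext_power_span[of "map term_pol L"] by (simp add: vs_def wedge_terms_def)

end

section \<open>Evaluation of polynomials\<close>

lemma pm_eq_sum_singles:
  fixes f :: "'b \<Rightarrow>\<^sub>0 'k::comm_monoid_add"
  shows "(\<Sum>t\<in>keys f. Poly_Mapping.single t (lookup f t)) = f"
proof (rule poly_mapping_eqI)
  fix u
  show "lookup (\<Sum>t\<in>keys f. Poly_Mapping.single t (lookup f t)) u = lookup f u"
    by (cases "u \<in> keys f") (auto simp: lookup_sum lookup_single when_def in_keys_iff)
qed

text \<open>The factor of \<open>eval_pol\<close> belonging to one term, over an arbitrary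
  commutative ring: its values are polynomials for the action, and field elements for matrix entries
  and torus weights.\<close>

definition monom_val :: "('v \<Rightarrow> 'r::comm_ring_1) \<Rightarrow> ('v \<Rightarrow>\<^sub>0 nat) \<Rightarrow> 'r" where
  "monom_val x t = (\<Prod>v\<in>keys t. x v ^ lookup t v)"

lemma monom_val_superset:
  "finite A \<Longrightarrow> keys t \<subseteq> A \<Longrightarrow> monom_val x t = (\<Prod>v\<in>A. x v ^ lookup t v)"
  unfolding monom_val_def by (rule prod.mono_neutral_left) (auto simp: in_keys_iff)

lemma monom_val_zero: "monom_val x 0 = 1"
  by (simp add: monom_val_def)

lemma monom_val_add: "monom_val x (s + t) = monom_val x s * monom_val x t"
  by (subst (1 2 3) monom_val_superset[of "keys s \<union> keys t"])
     (auto simp: lookup_add power_add prod.distrib dest!: set_mp[OF keys_add])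

lemma monom_val_cong: "(\<And>v. v \<in> keys t \<Longrightarrow> x v = y v) \<Longrightarrow> monom_val x t = monom_val y t"
  by (simp add: monom_val_def)

lemma monom_val_var_pol: "monom_val var_pol t = (term_pol t :: 'k::field pol)"
proof -
  have pow: "var_pol v ^ k = (term_pol (Poly_Mapping.single v k) :: 'k pol)" for v k
    by (induction k) (auto simp: mult_single simp flip: single_add)
  have prod: "(\<Prod>v\<in>A. term_pol (s v)) = (term_pol (\<Sum>v\<in>A. s v) :: 'k pol)"
    for A :: "nat set" and s :: "nat \<Rightarrow> trm"
    by (induction A rule: infinite_finite_induct) (auto simp: mult_single)
  show ?thesis
    unfolding monom_val_def pow prod pm_eq_sum_singles ..
qed

lemma eval_pol_eq: "eval_pol h x f = (\<Sum>t\<in>keys f. h (lookup f t) * monom_val x t)"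
  by (simp add: eval_pol_def monom_val_def)

lemma pm_induct [case_names zero single add]:
  fixes f :: "'b \<Rightarrow>\<^sub>0 'k::comm_monoid_add"
  assumes "P 0" "\<And>t c. P (Poly_Mapping.single t c)" "\<And>f g. P f \<Longrightarrow> P g \<Longrightarrow> P (f + g)"
  shows "P f"
proof -
  have "P (\<Sum>t\<in>A. Poly_Mapping.single t (lookup f t))" for A
    by (induction A rule: infinite_finite_induct) (auto intro: assms)
  from this[of "keys f"] show ?thesis by (simp add: pm_eq_sum_singles)
qed

text \<open>Treats two evaluations at once: coefficients embedded as constant polynomials, for the
  action, and \<open>id\<close>, for functions of the matrix entries.\<close>

locale eval_hom = h: comm_ring_hom h for h :: "'k::field \<Rightarrow> 'r::comm_ring_1"
begin

lemma eval_superset: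
  "finite A \<Longrightarrow> keys f \<subseteq> A \<Longrightarrow> eval_pol h x f = (\<Sum>t\<in>A. h (lookup f t) * monom_val x t)"
  unfolding eval_pol_eq by (rule sum.mono_neutral_left) (auto simp: in_keys_iff)

lemma eval_zero: "eval_pol h x 0 = 0"
  by (simp add: eval_pol_eq)

lemma eval_single: "eval_pol h x (Poly_Mapping.single t c) = h c * monom_val x t"
  by (simp add: eval_pol_eq)

lemma eval_add: "eval_pol h x (f + g) = eval_pol h x f + eval_pol h x g"
  by (subst (1 2 3) eval_superset[of "keys f \<union> keys g"])
     (auto simp: lookup_add h.hom_add distrib_right sum.distrib dest!: set_mp[OF keys_add])

lemma eval_mult: "eval_pol h x (f * g) = eval_pol h x f * eval_pol h x g"
proof (induction f rule: pm_induct)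
  case (single s c)
  show ?case
    by (induction g rule: pm_induct)
       (auto simp: eval_zero eval_single eval_add mult_single monom_val_add h.hom_mult
         algebra_simps)
qed (auto simp: eval_zero eval_add algebra_simps)

end

lemma eval_hom_const: "eval_hom (Poly_Mapping.single 0 :: 'k::field \<Rightarrow> 'k pol)"
  by unfold_locales (auto simp: single_add mult_single)

lemma eval_hom_id: "eval_hom (id :: 'k::field \<Rightarrow> 'k)"
  by unfold_locales auto

section \<open>The action of the general linear group\<close>

lemma pm_scale_eq_mult: "pm_scale c f = Poly_Mapping.single 0 c * (f :: ('a::monoid_add \<Rightarrow>\<^sub>0 'k::field))"
  by (simp add: pm_scale_def mult_map_scale_conv_mult)

definition subst_var :: "nat \<Rightarrow> 'k::field mat \<Rightarrow> nat \<Rightarrow> 'k pol" where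
  "subst_var n g i = (\<Sum>j\<le>n. pm_scale (g $$ (i, j)) (var_pol j))"

lemma act_eq: "act n g = eval_pol (Poly_Mapping.single 0) (subst_var n g)"
  by (simp add: act_def subst_var_def[abs_def])

lemma act_single: "act n g (Poly_Mapping.single t c) = pm_scale c (monom_val (subst_var n g) t)"
  by (simp add: act_eq eval_hom.eval_single[OF eval_hom_const] pm_scale_eq_mult)

lemma act_add: "act n g (f + f') = act n g f + act n g f'"
  by (simp add: act_eq eval_hom.eval_add[OF eval_hom_const])

lemma act_mult: "act n g (f * f') = act n g f * act n g f'"
  by (simp add: act_eq eval_hom.eval_mult[OF eval_hom_const])

lemma act_zero: "act n g 0 = 0"
  by (simp add: act_eq eval_hom.eval_zero[OF eval_hom_const])

lemma act_one: "act n g 1 = 1"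
  using act_single[of n g 0 1] by (simp add: monom_val_zero)

lemma act_scale: "act n g (pm_scale c f) = pm_scale c (act n g f)"
proof -
  have "act n g (Poly_Mapping.single 0 c) = Poly_Mapping.single 0 c"
    unfolding act_single monom_val_zero pm_scale_eq_mult by (rule mult_1_right)
  then show ?thesis by (simp only: pm_scale_eq_mult act_mult)
qed

lemma act_sum: "act n g (sum f A) = (\<Sum>a\<in>A. act n g (f a))"
  by (induction A rule: infinite_finite_induct) (auto simp: act_zero act_add)

lemma act_power: "act n g (f ^ k) = act n g f ^ k"
  by (induction k) (auto simp: act_one act_mult)

lemma act_prod: "act n g (prod f A) = (\<Prod>a\<in>A. act n g (f a))"
  by (induction A rule: infinite_finite_induct) (auto simp: act_one act_mult)

lemma module_hom_act: "module_hom pm_scale pm_scale (act n g)"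
  by unfold_locales (auto simp: act_add act_scale)

lemma act_span: "act n g ` pm.span S = pm.span (act n g ` S)"
  using module_hom.span_image[OF module_hom_act] by blast

lemma act_terms_expand:
  assumes "finite A" "keys f \<subseteq> A"
  shows "act n g f = (\<Sum>t\<in>A. pm_scale (lookup f t) (act n g (term_pol t)))"
  using arg_cong[OF pm_eq_sum_terms[OF assms], of "act n g"] by (simp add: act_sum act_scale)

text \<open>Reduces the composition law and the action of the identity to single terms. The
  restriction to \<open>terms n\<close> is there because for a larger variable index
  \<open>subst_var\<close> reads outside the matrix.\<close>

lemma act_cong:
  assumes "keys f \<subseteq> terms n" "\<And>t. t \<in> terms n \<Longrightarrow> act n g (term_pol t) = F (term_pol t)"
    and "module_hom pm_scale pm_scale F"
  shows "act n g f = F f"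
proof -
  interpret F: module_hom pm_scale pm_scale F by fact
  have "F f = F (\<Sum>t\<in>keys f. pm_scale (lookup f t) (term_pol t))"
    by (rule arg_cong[OF pm_eq_sum_terms[OF finite_keys subset_refl]])
  also have "\<dots> = (\<Sum>t\<in>keys f. pm_scale (lookup f t) (F (term_pol t)))"
    by (simp add: F.sum F.scale)
  also have "\<dots> = act n g f"
    unfolding act_terms_expand[OF finite_keys subset_refl, of n g f]
    using assms(1,2) by (intro sum.cong) auto
  finally show ?thesis ..
qed

lemma act_term: "act n g (term_pol t) = monom_val (subst_var n g) t"
  by (simp add: act_single pm_scale_eq_mult single_one)

lemma act_subst_var:
  assumes "g \<in> carrier_mat (n + 1) (n + 1)" "h \<in> carrier_mat (n + 1) (n + 1)" "v \<le> n"
  shows "act n g (subst_var n h v) = subst_var n (h * g) v"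
proof -
  have act_var: "act n g (var_pol j) = subst_var n g j" for j
    by (simp add: act_term monom_val_def)
  have "act n g (subst_var n h v)
      = (\<Sum>j\<le>n. \<Sum>k\<le>n. pm_scale (h $$ (v, j) * g $$ (j, k)) (var_pol k))"
    unfolding subst_var_def[of n h] act_sum act_scale act_var
    by (simp add: subst_var_def pm.scale_sum_right)
  also have "\<dots> = (\<Sum>k\<le>n. pm_scale (\<Sum>j\<le>n. h $$ (v, j) * g $$ (j, k)) (var_pol k))"
    by (subst sum.swap) (simp add: pm.scale_sum_left)
  also have "\<dots> = subst_var n (h * g) v"
  proof -
    have "(h * g) $$ (v, k) = (\<Sum>j\<le>n. h $$ (v, j) * g $$ (j, k))" if "k \<le> n" for k
      using that assms
      by (auto simp: scalar_prod_def atLeast0LessThan lessThan_Suc_atMost intro!: sum.cong)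
    then show ?thesis by (simp add: subst_var_def)
  qed
  finally show ?thesis .
qed

text \<open>Substitutions compose in reverse order, so this is a right action: the left factor of a
  matrix product acts first. This is why torus elements are multiplied from the left below.\<close>

lemma act_act:
  assumes "g \<in> carrier_mat (n + 1) (n + 1)" "h \<in> carrier_mat (n + 1) (n + 1)"
    and "keys f \<subseteq> terms n"
  shows "act n g (act n h f) = act n (h * g) f"
proof (rule act_cong[symmetric, OF assms(3)])
  show "module_hom pm_scale pm_scale (\<lambda>f. act n g (act n h f))"
    by unfold_locales (auto simp: act_add act_scale)
next
  fix t assume "t \<in> terms n"
  then show "act n (h * g) (term_pol t) = act n g (act n h (term_pol t))"
    using act_subst_var[OF assms(1,2)]
    by (auto simp: act_term monom_val_def act_prod act_power terms_def intro!: prod.cong)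
qed

lemma act_one_mat:
  assumes "keys f \<subseteq> terms n"
  shows "act n (1\<^sub>m (n + 1)) f = f"
proof (rule act_cong[OF assms])
  show "module_hom pm_scale pm_scale (\<lambda>f. f)" by unfold_locales auto
next
  fix t assume t: "t \<in> terms n"
  have "subst_var n (1\<^sub>m (n + 1)) v = var_pol v" if "v \<le> n" for v
  proof -
    have "subst_var n (1\<^sub>m (n + 1)) v = (\<Sum>j\<le>n. if j = v then var_pol j else 0)"
      unfolding subst_var_def using that by (intro sum.cong) auto
    then show ?thesis using that by simp
  qed
  then have "act n (1\<^sub>m (n + 1)) (term_pol t) = monom_val var_pol t"
    unfolding act_term using t by (intro monom_val_cong) (auto simp: terms_def)
  then show "act n (1\<^sub>m (n + 1)) (term_pol t) = term_pol t"
    by (simp only: monom_val_var_pol)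
qed

section \<open>The general linear group and its action on the Grassmannian\<close>

lemma mem_GL_iff: "g \<in> GL n \<longleftrightarrow> g \<in> carrier_mat (n + 1) (n + 1) \<and> det g \<noteq> (0::'k::field)"
proof -
  have "invertible_mat g \<longleftrightarrow> det g \<noteq> 0" if g: "g \<in> carrier_mat (n + 1) (n + 1)"
  proof
    assume "invertible_mat g"
    then obtain h where h: "g * h = 1\<^sub>m (n + 1)" "h * g = 1\<^sub>m (dim_row h)"
      using g by (auto simp: invertible_mat_def inverts_mat_def)
    then have "h \<in> carrier_mat (n + 1) (n + 1)"
      using g by (metis carrier_matD(2) carrier_mat_triv index_mult_mat(2,3) index_one_mat(2,3))
    with det_mult[OF g this] h show "det g \<noteq> 0" by auto
  next
    assume "det g \<noteq> 0"
    from det_non_zero_imp_unit[OF g this, of "()"] show "invertible_mat g"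
      using g by (auto simp: Units_def ring_mat_def invertible_mat_def inverts_mat_def)
  qed
  then show ?thesis by (auto simp: GL_def)
qed

lemma GL_carrier: "g \<in> GL n \<Longrightarrow> g \<in> carrier_mat (n + 1) (n + 1)"
  by (simp add: GL_def)

lemma GL_one: "1\<^sub>m (n + 1) \<in> GL n"
  unfolding mem_GL_iff by simp

lemma GL_mult: "g \<in> GL n \<Longrightarrow> h \<in> GL n \<Longrightarrow> g * h \<in> GL n"
  unfolding mem_GL_iff using det_mult[of g "n + 1" h] by auto

lemma GL_inverse:
  assumes "g \<in> GL n"
  obtains h where "h \<in> GL n" "g * h = 1\<^sub>m (n + 1)" "h * g = 1\<^sub>m (n + 1)"
proof -
  have g: "g \<in> carrier_mat (n + 1) (n + 1)" "det g \<noteq> 0" using assms mem_GL_iff by blast+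
  obtain h where h: "h \<in> carrier_mat (n + 1) (n + 1)" "g * h = 1\<^sub>m (n + 1)" "h * g = 1\<^sub>m (n + 1)"
    using det_non_zero_imp_unit[OF g, of "()"] by (auto simp: Units_def ring_mat_def)
  then have "det h \<noteq> 0" using det_mult[OF g(1) h(1)] by auto
  with h show thesis using that mem_GL_iff by blast
qed

lemma terms_deg_add:
  assumes "s \<in> terms_deg n a" "t \<in> terms_deg n b"
  shows "s + t \<in> terms_deg n (a + b)"
proof -
  have deg: "(\<Sum>i\<in>keys u. lookup u i) = (\<Sum>i\<le>n. lookup u i)" if "u \<in> terms n" for u
    using that by (intro sum.mono_neutral_left) (auto simp: terms_def in_keys_iff)
  have "s \<in> terms n" "t \<in> terms n" using assms by (auto simp: terms_deg_def)
  with assms show ?thesis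
    using deg[OF terms_add, of s t] by (simp add: terms_deg_def terms_add deg lookup_add sum.distrib)
qed

lemma homogeneous_mult:
  assumes "f \<in> homogeneous n a" "g \<in> homogeneous n b"
  shows "f * g \<in> homogeneous n (a + b)"
  using assms keys_mult[of f g] terms_deg_add[of _ n a _ b] unfolding homogeneous_def by blast

lemma homogeneous_one: "1 \<in> homogeneous n 0"
  by (simp add: homogeneous_def terms_deg_def terms_def)

lemma homogeneous_power: "f \<in> homogeneous n a \<Longrightarrow> f ^ k \<in> homogeneous n (k * a)"
  by (induction k) (auto simp: homogeneous_one homogeneous_mult)

lemma homogeneous_prod:
  "(\<And>i. i \<in> A \<Longrightarrow> f i \<in> homogeneous n (d i)) \<Longrightarrow> prod f A \<in> homogeneous n (sum d A)"
  by (induction A rule: infinite_finite_induct) (auto simp: homogeneous_one homogeneous_mult)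

lemma subspace_homogeneous: "pm.subspace (homogeneous n m :: 'k::field pol set)"
proof (rule pm.subspaceI)
  fix f g :: "'k pol" and c
  assume "f \<in> homogeneous n m" "g \<in> homogeneous n m"
  then show "f + g \<in> homogeneous n m" "pm_scale c f \<in> homogeneous n m"
    using keys_add[of f g] by (auto simp: homogeneous_def in_keys_iff subset_iff)
qed (simp add: homogeneous_def)

lemma term_pol_homogeneous: "t \<in> terms_deg n m \<Longrightarrow> term_pol t \<in> homogeneous n m"
  by (simp add: homogeneous_def)

lemma act_homogeneous:
  assumes "f \<in> homogeneous n m"
  shows "act n g f \<in> homogeneous n m"
proof -
  have "var_pol j \<in> homogeneous n 1" if "j \<le> n" for j
    using that by (simp add: homogeneous_def terms_deg_def terms_def)
  then have lin: "subst_var n g i \<in> homogeneous n 1" for i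
    unfolding subst_var_def
    by (intro pm.subspace_sum pm.subspace_scale subspace_homogeneous) auto
  have "act n g (term_pol t) \<in> homogeneous n m" if "t \<in> terms_deg n m" for t
  proof -
    have "(\<Prod>v\<in>keys t. subst_var n g v ^ lookup t v) \<in> homogeneous n (\<Sum>v\<in>keys t. lookup t v * 1)"
      by (intro homogeneous_prod homogeneous_power lin)
    then show ?thesis using that by (simp add: act_term monom_val_def terms_deg_def)
  qed
  then show ?thesis
    unfolding act_terms_expand[OF finite_keys subset_refl, of n g f] using assms
    by (intro pm.subspace_sum pm.subspace_scale subspace_homogeneous) (auto simp: homogeneous_def)
qed

text \<open>Applied to a group element and to its inverse, this shows that the action preserves
  dimension. Homogeneity supplies the finite basis through which \<open>dim\<close> is compared with
  cardinalities.\<close>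

lemma dim_image_le:
  assumes V: "V \<subseteq> homogeneous n m" and F: "module_hom pm_scale pm_scale F"
  shows "pm.dim (F ` V) \<le> pm.dim V"
proof -
  obtain B where B: "B \<subseteq> V" "pm.independent B" "V \<subseteq> pm.span B" "card B = pm.dim V"
    using pm.basis_exists by blast
  have "B \<subseteq> pm.span (term_pol ` terms_deg n m)"
    using B(1) V homogeneous_subset_span by blast
  then have "finite B"
    using pm.independent_span_bound[OF _ B(2)] finite_terms_deg by blast
  have "F ` V \<subseteq> pm.span (F ` B)"
    using B(3) module_hom.span_image[OF F, of B] by blast
  then have "pm.dim (F ` V) \<le> card (F ` B)"
    using \<open>finite B\<close> by (intro pm.dim_le_card) auto
  also have "\<dots> \<le> card B" using \<open>finite B\<close> by (rule card_image_le)
  finally show ?thesis by (simp add: B(4))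
qed

lemma act_Gr:
  assumes "V \<in> Gr n m q" "g \<in> GL n"
  shows "act n g ` V \<in> Gr n m q"
proof -
  have V: "pm.subspace V" "V \<subseteq> homogeneous n m" "pm.dim V = q" using assms(1) by (auto simp: Gr_def)
  obtain h where h: "h \<in> GL n" "g * h = 1\<^sub>m (n + 1)" using GL_inverse assms(2) by blast
  have "keys f \<subseteq> terms n" if "f \<in> V" for f
    using that V(2) terms_deg_subset_terms[of n m] unfolding homogeneous_def by blast
  then have "act n h (act n g f) = f" if "f \<in> V" for f
    using that act_act[OF GL_carrier[OF h(1)] GL_carrier[OF assms(2)]] h(2) act_one_mat by metis
  then have "act n h ` act n g ` V = V" by force
  moreover have hom: "act n g ` V \<subseteq> homogeneous n m" using V(2) act_homogeneous by blast
  ultimately have "pm.dim (act n g ` V) = q"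
    using dim_image_le[OF V(2) module_hom_act, of n g] dim_image_le[OF hom module_hom_act, of n h] V(3)
    by simp
  with V hom show ?thesis
    using module_hom.subspace_image[OF module_hom_act V(1)] by (simp add: Gr_def)
qed

lemma orbit_act:
  assumes "V \<in> Gr n m q" "g \<in> GL n" "h \<in> GL n"
  shows "act n h ` act n g ` V \<in> orbit n V"
proof -
  have "keys f \<subseteq> terms n" if "f \<in> V" for f
    using that assms(1) terms_deg_subset_terms[of n m] unfolding Gr_def homogeneous_def by blast
  then have "act n h ` act n g ` V = act n (g * h) ` V"
    using act_act[OF GL_carrier[OF assms(3)] GL_carrier[OF assms(2)]] by (simp add: image_image)
  then show ?thesis using GL_mult[OF assms(2,3)] unfolding orbit_def by blast
qed

section \<open>Torus elements and upper triangular matrices\<close>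

lemma scale_rows_GL:
  assumes "g \<in> GL n" "\<And>i. d i \<noteq> (0::'k::field)"
  shows "mat (n + 1) (n + 1) (\<lambda>(i, j). d i * g $$ (i, j)) \<in> GL n"
proof -
  have "mat (n + 1) (n + 1) (\<lambda>(i, j). d i * g $$ (i, j)) = mat_diag (n + 1) d * g"
    using GL_carrier[OF assms(1)] by (subst mat_diag_mult_left[of _ _ "n + 1"]) auto
  moreover have "mat_diag (n + 1) d \<in> GL n"
  proof -
    have "upper_triangular (mat_diag (n + 1) d)"
      by (auto simp: upper_triangular_def mat_diag_def)
    then have "det (mat_diag (n + 1) d) = prod_list (diag_mat (mat_diag (n + 1) d))"
      by (rule det_upper_triangular[where n = "n + 1"]) simp
    then show ?thesis
      using assms(2) by (auto simp: mem_GL_iff diag_mat_def mat_diag_def)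
  qed
  ultimately show ?thesis using GL_mult assms(1) by metis
qed

text \<open>Scaling row \<open>i\<close> by \<open>d i\<close> scales the image of variable
  \<open>i\<close>: the diagonal matrix acts before \<open>g\<close>, and on a term it acts through
  the character \<open>monom_val d t\<close>.\<close>

lemma act_scale_rows:
  assumes "t \<in> terms n"
  shows "act n (mat (n + 1) (n + 1) (\<lambda>(i, j). d i * g $$ (i, j))) (term_pol t) =
    pm_scale (monom_val d t) (act n g (term_pol t))"
proof -
  have "subst_var n (mat (n + 1) (n + 1) (\<lambda>(i, j). d i * g $$ (i, j))) v
      = Poly_Mapping.single 0 (d v) * subst_var n g v" if "v \<le> n" for v
    using that by (auto simp: subst_var_def pm.scale_sum_right simp flip: pm_scale_eq_mult intro!: sum.cong)
  then have "act n (mat (n + 1) (n + 1) (\<lambda>(i, j). d i * g $$ (i, j))) (term_pol t)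
      = (\<Prod>v\<in>keys t. (Poly_Mapping.single 0 (d v) * subst_var n g v) ^ lookup t v)"
    unfolding act_term monom_val_def using assms by (intro prod.cong) (auto simp: terms_def)
  also have "\<dots> = (\<Prod>v\<in>keys t. Poly_Mapping.single 0 (d v) ^ lookup t v) * monom_val (subst_var n g) t"
    by (simp add: power_mult_distrib prod.distrib monom_val_def)
  also have "(\<Prod>v\<in>keys t. Poly_Mapping.single 0 (d v) ^ lookup t v)
      = (Poly_Mapping.single 0 (monom_val d t) :: 'a pol)"
  proof -
    interpret eval_hom "Poly_Mapping.single 0 :: 'a \<Rightarrow> 'a pol" by (rule eval_hom_const)
    show ?thesis by (simp add: monom_val_def h.hom_prod h.hom_power)
  qed
  finally show ?thesis by (simp add: act_term pm_scale_eq_mult)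
qed

context ordered_terms
begin

text \<open>A variable is sent to a combination of itself and variables of larger index, hence of
  larger terms; compatibility of the order with products carries this lower bound over to all
  terms.\<close>

lemma act_upper_triangular_ge:
  assumes g: "upper_triangular g" "g \<in> carrier_mat (n + 1) (n + 1)" and t: "t \<in> terms n"
    and u: "u \<in> keys (act n g (term_pol t))"
  shows "tle t u"
proof -
  \<comment> \<open>Polynomials bounded below by \<open>t\<close>; membership in
    \<open>terms n\<close> is carried along because \<open>tlt\<close> is an order only
    there.\<close>
  define up :: "trm \<Rightarrow> 'a pol set" where "up t = {f. \<forall>u\<in>keys f. u \<in> terms n \<and> tle t u}" for t
  have up_mult: "f * f' \<in> up (s + s')"
    if "f \<in> up s" "f' \<in> up s'" "s \<in> terms n" "s' \<in> terms n" for f f' s s'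
  proof -
    have "u \<in> terms n \<and> tle (s + s') u" if "u \<in> keys (f * f')" for u
    proof -
      obtain a b where "u = a + b" "a \<in> keys f" "b \<in> keys f'"
        using \<open>u \<in> keys (f * f')\<close> keys_mult[of f f'] by blast
      with that \<open>f \<in> up s\<close> \<open>f' \<in> up s'\<close> \<open>s \<in> terms n\<close> \<open>s' \<in> terms n\<close> show ?thesis
        using tle_add(1)[of s a s' b] terms_add by (auto simp: up_def)
    qed
    then show ?thesis by (auto simp: up_def)
  qed
  have single_terms: "Poly_Mapping.single i k \<in> terms n" if "i \<le> n" for i k
    using that by (simp add: terms_def)
  have lin: "subst_var n g i \<in> up (Poly_Mapping.single i 1)" if i: "i \<le> n" for i
  proof -
    have "u \<in> terms n \<and> tle (Poly_Mapping.single i 1) u" if "u \<in> keys (subst_var n g i)" for u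
    proof -
      have "u \<in> (\<Union>j\<in>{..n}. keys (pm_scale (g $$ (i, j)) (var_pol j)))"
        using subsetD[OF keys_sum that[unfolded subst_var_def]] .
      then obtain j where "j \<le> n" "u \<in> keys (pm_scale (g $$ (i, j)) (var_pol j))" by blast
      then have "j \<le> n" "g $$ (i, j) * lookup (var_pol j) u \<noteq> 0"
        by (simp_all only: in_keys_iff lookup_pm_scale not_False_eq_True)
      then have j: "j \<le> n" "g $$ (i, j) \<noteq> 0" "u = Poly_Mapping.single j 1"
        by (simp_all add: lookup_single when_def split: if_splits)
      have "i \<le> j"
        by (rule ccontr) (use upper_triangularD[OF g(1), of j i] j(1,2) g(2) i in auto)
      then show ?thesis
        using j i single_terms term_order unfolding term_order_def by (cases "i = j") auto
    qed
    then show ?thesis by (auto simp: up_def)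
  qed
  have one: "1 \<in> up 0" by (simp add: up_def zero_in_terms)
  have pow: "subst_var n g i ^ k \<in> up (Poly_Mapping.single i k)" if i: "i \<le> n" for i k
  proof (induction k)
    case (Suc k)
    have "subst_var n g i * subst_var n g i ^ k \<in> up (Poly_Mapping.single i 1 + Poly_Mapping.single i k)"
      by (intro up_mult lin single_terms Suc i)
    then show ?case by (simp flip: single_add)
  qed (simp add: one)
  have "(\<Prod>v\<in>A. subst_var n g v ^ lookup t v) \<in> up (\<Sum>v\<in>A. Poly_Mapping.single v (lookup t v))"
    if "A \<subseteq> {..n}" for A
    using that
  proof (induction A rule: infinite_finite_induct)
    case (insert x A)
    then show ?case by (auto intro!: up_mult pow single_terms terms_sum)
  qed (auto simp: one)
  from this[of "keys t"] u t show ?thesis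
    by (simp add: act_term monom_val_def pm_eq_sum_singles up_def terms_def)
qed

end

section \<open>Zariski open subsets\<close>

text \<open>Has the shape of the defining functions in \<open>zariski_open_GL\<close>. The identity
  is demanded for singular matrices too, so that it can be evaluated along a line that leaves
  GL.\<close>

definition regular_fun :: "nat \<Rightarrow> ('k::field mat \<Rightarrow> 'k) \<Rightarrow> bool" where
  "regular_fun n F \<longleftrightarrow> (\<exists>p. (\<forall>t\<in>keys p. keys t \<subseteq> {..n} \<times> {..n}) \<and>
     (\<forall>g. F g = eval_pol id (\<lambda>ij. g $$ ij) p))"

lemma regular_fun_const: "regular_fun n (\<lambda>g. c)"
  unfolding regular_fun_def
  by (intro exI[of _ "Poly_Mapping.single 0 c"])
     (auto simp: eval_hom.eval_single[OF eval_hom_id] monom_val_zero)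

lemma regular_fun_entry: "i \<le> n \<Longrightarrow> j \<le> n \<Longrightarrow> regular_fun n (\<lambda>g. g $$ (i, j))"
  unfolding regular_fun_def
  by (intro exI[of _ "Poly_Mapping.single (Poly_Mapping.single (i, j) 1) 1"])
     (auto simp: eval_hom.eval_single[OF eval_hom_id] monom_val_def)

lemma regular_fun_add:
  assumes "regular_fun n F" "regular_fun n G"
  shows "regular_fun n (\<lambda>g. F g + G g)"
proof -
  obtain p p' where "\<forall>t\<in>keys p. keys t \<subseteq> {..n} \<times> {..n}" "\<forall>t\<in>keys p'. keys t \<subseteq> {..n} \<times> {..n}"
      and F: "F = (\<lambda>g. eval_pol id (\<lambda>ij. g $$ ij) p)" "G = (\<lambda>g. eval_pol id (\<lambda>ij. g $$ ij) p')"
    using assms unfolding regular_fun_def by blast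
  then have "\<forall>t\<in>keys (p + p'). keys t \<subseteq> {..n} \<times> {..n}"
    using keys_add[of p p'] by blast
  then show ?thesis
    unfolding regular_fun_def F by (intro exI[of _ "p + p'"]) (simp add: eval_hom.eval_add[OF eval_hom_id])
qed

lemma regular_fun_mult:
  assumes "regular_fun n F" "regular_fun n G"
  shows "regular_fun n (\<lambda>g. F g * G g)"
proof -
  obtain p p' where p: "\<forall>t\<in>keys p. keys t \<subseteq> {..n} \<times> {..n}" "\<forall>t\<in>keys p'. keys t \<subseteq> {..n} \<times> {..n}"
      and F: "F = (\<lambda>g. eval_pol id (\<lambda>ij. g $$ ij) p)" "G = (\<lambda>g. eval_pol id (\<lambda>ij. g $$ ij) p')"
    using assms unfolding regular_fun_def by blast
  have "keys t \<subseteq> {..n} \<times> {..n}" if "t \<in> keys (p * p')" for t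
  proof -
    from subsetD[OF keys_mult that] obtain a b where "t = a + b" "a \<in> keys p" "b \<in> keys p'"
      by blast
    with p keys_add[of a b] show ?thesis by blast
  qed
  then show ?thesis
    unfolding regular_fun_def F
    by (intro exI[of _ "p * p'"]) (simp add: eval_hom.eval_mult[OF eval_hom_id])
qed

lemma regular_fun_sum: "(\<And>a. a \<in> A \<Longrightarrow> regular_fun n (F a)) \<Longrightarrow> regular_fun n (\<lambda>g. \<Sum>a\<in>A. F a g)"
  by (induction A rule: infinite_finite_induct) (auto intro: regular_fun_const regular_fun_add)

lemma regular_fun_prod: "(\<And>a. a \<in> A \<Longrightarrow> regular_fun n (F a)) \<Longrightarrow> regular_fun n (\<lambda>g. \<Prod>a\<in>A. F a g)"
  by (induction A rule: infinite_finite_induct) (auto intro: regular_fun_const regular_fun_mult)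

text \<open>The matrix is rebuilt from its entries because \<open>det\<close> depends on the
  dimensions of its argument, which a polynomial in the entries cannot see.\<close>

lemma regular_fun_det: "regular_fun n (\<lambda>g. det (mat (n + 1) (n + 1) (\<lambda>ij. g $$ ij)))"
proof -
  have det: "det (mat (n + 1) (n + 1) (\<lambda>ij. g $$ ij)) =
      (\<Sum>p | p permutes {0..<n + 1}. signof p * (\<Prod>i = 0..<n + 1. g $$ (i, p i)))" for g :: "'a mat"
    by (subst det_def'[of _ "n + 1"]) (auto intro!: sum.cong prod.cong)
  have "p i \<le> n" if "p permutes {0..<n + 1}" "i < n + 1" for p i
    using permutes_in_image[OF that(1), of i] that(2) by auto
  then show ?thesis
    unfolding det
    by (intro regular_fun_sum regular_fun_mult regular_fun_const regular_fun_prod regular_fun_entry) auto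
qed

text \<open>Families of polynomials with coefficients regular in \<open>g\<close>, presented as
  finite sums whose exponents do not depend on \<open>g\<close>. They are closed under products, so
  they contain the action; extracting coefficients then makes the minors regular.\<close>

inductive regular_pol :: "nat \<Rightarrow> ('k::field mat \<Rightarrow> 'k pol) \<Rightarrow> bool" for n where
  single: "regular_fun n \<phi> \<Longrightarrow> regular_pol n (\<lambda>g. Poly_Mapping.single t (\<phi> g))"
| add: "regular_pol n F \<Longrightarrow> regular_pol n G \<Longrightarrow> regular_pol n (\<lambda>g. F g + G g)"

lemma regular_pol_const: "regular_pol n (\<lambda>g. c)"
proof (induction c rule: pm_induct)
  case zero
  show ?case using regular_pol.single[OF regular_fun_const, of n 0 0] by simp
qed (auto intro: regular_pol.intros regular_fun_const)

lemma regular_pol_mult: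
  assumes "regular_pol n F" "regular_pol n G"
  shows "regular_pol n (\<lambda>g. F g * G g)"
  using assms(1)
proof induction
  case (single \<phi> s)
  show ?case
    using assms(2)
    by induction (auto simp: mult_single distrib_left single intro!: regular_pol.intros regular_fun_mult)
qed (auto simp: distrib_right intro: regular_pol.add)

lemma regular_pol_sum: "(\<And>a. a \<in> A \<Longrightarrow> regular_pol n (F a)) \<Longrightarrow> regular_pol n (\<lambda>g. \<Sum>a\<in>A. F a g)"
  by (induction A rule: infinite_finite_induct) (auto intro: regular_pol_const regular_pol.add)

lemma regular_pol_prod: "(\<And>a. a \<in> A \<Longrightarrow> regular_pol n (F a)) \<Longrightarrow> regular_pol n (\<lambda>g. \<Prod>a\<in>A. F a g)"
  by (induction A rule: infinite_finite_induct) (auto intro: regular_pol_const regular_pol_mult)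

lemma regular_pol_power: "regular_pol n F \<Longrightarrow> regular_pol n (\<lambda>g. F g ^ k)"
  by (induction k) (auto intro: regular_pol_const regular_pol_mult)

lemma regular_fun_lookup: "regular_pol n F \<Longrightarrow> regular_fun n (\<lambda>g. lookup (F g) t)"
proof (induction rule: regular_pol.induct)
  case (single \<phi> s)
  then show ?case by (cases "s = t") (auto simp: lookup_single regular_fun_const)
qed (simp add: lookup_add regular_fun_add)

lemma regular_pol_act:
  assumes "keys f \<subseteq> terms n"
  shows "regular_pol n (\<lambda>g. act n g f)"
proof -
  have scale: "pm_scale c (var_pol j) = Poly_Mapping.single (Poly_Mapping.single j 1) c"
    for c :: 'a and j
    by (auto intro!: poly_mapping_eqI simp: lookup_single when_def)
  show ?thesis
    unfolding act_terms_expand[OF finite_keys subset_refl, of n _ f] act_term monom_val_def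
      pm_scale_eq_mult[of _ "prod _ _"] subst_var_def scale
    using assms
    by (intro regular_pol_sum regular_pol_mult regular_pol_const regular_pol_prod
        regular_pol_power regular_pol.single regular_fun_entry)
       (auto simp: terms_def)
qed

lemma regular_fun_minor_act:
  assumes "\<And>f. f \<in> set fs \<Longrightarrow> keys f \<subseteq> terms n" "length L = length fs"
  shows "regular_fun n (\<lambda>g. minor L (map (act n g) fs))"
proof -
  have minor: "minor L (map (act n g) fs) = (\<Sum>p | p permutes {0..<length L}.
      signof p * (\<Prod>i = 0..<length L. lookup (act n g (fs ! i)) (L ! p i)))" for g
    unfolding minor_leibniz using assms(2) by (auto intro!: sum.cong prod.cong)
  show ?thesis
    unfolding minor
    by (intro regular_fun_sum regular_fun_mult regular_fun_const regular_fun_prod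
        regular_fun_lookup regular_pol_act assms(1))
       (use assms(2) in auto)
qed

text \<open>\<open>r\<close> is the same polynomial evaluated in the ring of univariate polynomials,
  at the linear polynomials that parametrize the entries of the line from \<open>a\<close> to
  \<open>b\<close>.\<close>

lemma regular_fun_line:
  fixes a b :: "'k::field mat"
  assumes "regular_fun n F"
  obtains r where "\<And>x. poly r x = F (mat (n + 1) (n + 1) (\<lambda>ij. a $$ ij + x * (b $$ ij - a $$ ij)))"
proof -
  obtain p where p: "\<And>t. t \<in> keys p \<Longrightarrow> keys t \<subseteq> {..n} \<times> {..n}"
    "\<And>g. F g = eval_pol id (\<lambda>ij. g $$ ij) p"
    using assms unfolding regular_fun_def by blast
  show thesis
  proof
    fix x
    show "poly (eval_pol (\<lambda>c. [:c:]) (\<lambda>ij. [:a $$ ij, b $$ ij - a $$ ij:]) p) x =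
        F (mat (n + 1) (n + 1) (\<lambda>ij. a $$ ij + x * (b $$ ij - a $$ ij)))"
      unfolding p(2) eval_pol_def poly_sum poly_mult poly_prod poly_power
    proof (intro sum.cong prod.cong arg_cong2[of _ _ _ _ "(*)"] arg_cong2[of _ _ _ _ "(^)"] refl)
      fix t ij assume "t \<in> keys p" "ij \<in> keys t"
      then have "ij \<in> {..n} \<times> {..n}" using p(1) by blast
      then show "poly [:a $$ ij, b $$ ij - a $$ ij:] x =
          mat (n + 1) (n + 1) (\<lambda>ij. a $$ ij + x * (b $$ ij - a $$ ij)) $$ ij" by auto
    qed simp
  qed
qed

lemma poly_nonzero_point:
  assumes "infinite (UNIV :: 'k::field set)" "r \<noteq> (0 :: 'k poly)"
  obtains x where "poly r x \<noteq> 0"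
proof -
  have "finite {x. poly r x = 0}" using assms(2) by (rule poly_roots_finite)
  with assms(1) have "{x. poly r x = 0} \<noteq> UNIV" by auto
  then show thesis using that by blast
qed

text \<open>Two points of \<open>GL\<close> are joined by a line, on which the determinant and the two defining
  functions are non-zero univariate polynomials.\<close>

lemma zariski_open_GL_intersect:
  assumes inf: "infinite (UNIV :: 'k::field set)"
    and U: "zariski_open_GL n U" "U \<noteq> {}" and U': "zariski_open_GL n U'" "U' \<noteq> {}"
  shows "U \<inter> (U' :: 'k mat set) \<noteq> {}"
proof -
  \<comment> \<open>A non-empty open set contains the non-vanishing locus in GL of one regular
    function: keep a single defining polynomial and a point where it is non-zero.\<close>
  have open_fun: "\<exists>F a. regular_fun n F \<and> a \<in> GL n \<and> F a \<noteq> 0 \<and> (\<forall>g\<in>GL n. F g \<noteq> 0 \<longrightarrow> g \<in> U)"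
    if "zariski_open_GL n U" "U \<noteq> {}" for U :: "'k mat set"
  proof -
    from that(1) obtain P :: "((nat \<times> nat \<Rightarrow>\<^sub>0 nat) \<Rightarrow>\<^sub>0 'k) set" where
      P: "\<forall>p\<in>P. \<forall>t\<in>keys p. keys t \<subseteq> {..n} \<times> {..n}"
      "U = {g \<in> GL n. \<exists>p\<in>P. eval_pol id (\<lambda>ij. g $$ ij) p \<noteq> 0}"
      unfolding zariski_open_GL_def by (elim exE conjE)
    with that(2) obtain a p where "a \<in> GL n" "p \<in> P" "eval_pol id (\<lambda>ij. a $$ ij) p \<noteq> 0" by blast
    with P show ?thesis
      by (intro exI[of _ "\<lambda>g. eval_pol id (\<lambda>ij. g $$ ij) p"] exI[of _ a]) (auto simp: regular_fun_def)
  qed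
  obtain F a where F: "regular_fun n F" "a \<in> GL n" "F a \<noteq> 0" "\<And>g. g \<in> GL n \<Longrightarrow> F g \<noteq> 0 \<Longrightarrow> g \<in> U"
    using open_fun[OF U] by blast
  obtain F' b where F': "regular_fun n F'" "b \<in> GL n" "F' b \<noteq> 0" "\<And>g. g \<in> GL n \<Longrightarrow> F' g \<noteq> 0 \<Longrightarrow> g \<in> U'"
    using open_fun[OF U'] by blast
  define M where "M x = mat (n + 1) (n + 1) (\<lambda>ij. a $$ ij + x * (b $$ ij - a $$ ij))" for x :: 'k
  have M_eta: "mat (n + 1) (n + 1) (\<lambda>ij. M x $$ ij) = M x" for x
    by (rule eq_matI) (auto simp: M_def)
  have M: "M 0 = a" "M 1 = b" "\<And>x. M x \<in> carrier_mat (n + 1) (n + 1)"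
    using GL_carrier[OF F(2)] GL_carrier[OF F'(2)] by (auto simp: M_def intro!: eq_matI)
  obtain r where r: "\<And>x. poly r x = F (M x)"
    using regular_fun_line[OF F(1), of a b] unfolding M_def by blast
  obtain r' where r': "\<And>x. poly r' x = F' (M x)"
    using regular_fun_line[OF F'(1), of a b] unfolding M_def by blast
  obtain d where d: "\<And>x. poly d x = det (M x)"
    using regular_fun_line[OF regular_fun_det, of n a b] unfolding M_def[symmetric] M_eta by blast
  have "r \<noteq> 0" "r' \<noteq> 0" "d \<noteq> 0"
    using r[of 0] r'[of 1] d[of 0] M(1,2) F(2,3) F'(3) by (auto simp: mem_GL_iff)
  then have "r * r' * d \<noteq> 0" by simp
  then obtain x where "poly (r * r' * d) x \<noteq> 0" using poly_nonzero_point[OF inf] by blast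
  then have "M x \<in> GL n" "F (M x) \<noteq> 0" "F' (M x) \<noteq> 0"
    using r[of x] r'[of x] d[of x] M(3) by (auto simp: mem_GL_iff)
  then show ?thesis using F(4) F'(4) by blast
qed

lemma zariski_open_regular_fun: "regular_fun n F \<Longrightarrow> zariski_open_GL n {g \<in> GL n. F g \<noteq> 0}"
proof -
  assume "regular_fun n F"
  then obtain p where "\<forall>t\<in>keys p. keys t \<subseteq> {..n} \<times> {..n}" "\<And>g. F g = eval_pol id (\<lambda>ij. g $$ ij) p"
    unfolding regular_fun_def by blast
  then show ?thesis unfolding zariski_open_GL_def by (intro exI[of _ "{p}"]) auto
qed

section \<open>Generic initial spaces\<close>

text \<open>The lowest digit is recovered modulo \<open>B\<close>; cancelling it and dividing by
  \<open>B\<close> leaves the shifted digits for the induction.\<close>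

lemma base_digits_inject:
  fixes a b :: "nat \<Rightarrow> nat"
  assumes "(\<Sum>i\<le>n. a i * B ^ i) = (\<Sum>i\<le>n. b i * B ^ i)"
    and "\<And>i. i \<le> n \<Longrightarrow> a i < B" "\<And>i. i \<le> n \<Longrightarrow> b i < B"
  shows "\<forall>i\<le>n. a i = b i"
  using assms
proof (induction n arbitrary: a b)
  case (Suc n)
  have split: "(\<Sum>i\<le>Suc n. c i * B ^ i) = c 0 + B * (\<Sum>i\<le>n. c (Suc i) * B ^ i)" for c :: "nat \<Rightarrow> nat"
    by (simp only: sum.atMost_Suc_shift) (simp add: sum_distrib_left algebra_simps)
  have eq: "a 0 + B * (\<Sum>i\<le>n. a (Suc i) * B ^ i) = b 0 + B * (\<Sum>i\<le>n. b (Suc i) * B ^ i)"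
    using Suc.prems(1) unfolding split .
  have lt: "a 0 < B" "b 0 < B" using Suc.prems by auto
  have "a 0 = b 0" using arg_cong[OF eq, of "\<lambda>x. x mod B"] lt by simp
  moreover have "(\<Sum>i\<le>n. a (Suc i) * B ^ i) = (\<Sum>i\<le>n. b (Suc i) * B ^ i)"
    using eq lt calculation by simp
  then have "\<forall>i\<le>n. a (Suc i) = b (Suc i)" using Suc.prems by (intro Suc.IH) auto
  ultimately show ?case by (metis Suc_le_mono not0_implies_Suc)
qed simp

text \<open>Multilinearity in all rows at once: \<open>s\<close> records which summand is taken from
  each row.\<close>

lemma minor_sum_rows:
  assumes "finite A" "length M = q" "\<And>i. i < q \<Longrightarrow> zs ! i = (\<Sum>t\<in>A. pm_scale (a i t) (b t))"
  shows "minor M zs = (\<Sum>s\<in>PiE {0..<q} (\<lambda>_. A).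
    (\<Prod>i = 0..<q. a i (s i)) * minor M (map (\<lambda>i. b (s i)) [0..<q]))"
proof -
  have "minor M zs = (\<Sum>p | p permutes {0..<q}. signof p *
      (\<Prod>i = 0..<q. \<Sum>t\<in>A. a i t * lookup (b t) (M ! p i)))"
    unfolding minor_leibniz assms(2) using assms(3) by (simp add: lookup_sum)
  also have "\<dots> = (\<Sum>p | p permutes {0..<q}. \<Sum>s\<in>PiE {0..<q} (\<lambda>_. A).
      (\<Prod>i = 0..<q. a i (s i)) * (signof p * (\<Prod>i = 0..<q. lookup (b (s i)) (M ! p i))))"
    using assms(1) by (subst prod_sum_PiE) (auto simp: sum_distrib_left prod.distrib algebra_simps)
  also have "\<dots> = (\<Sum>s\<in>PiE {0..<q} (\<lambda>_. A).
      (\<Prod>i = 0..<q. a i (s i)) * minor M (map (\<lambda>i. b (s i)) [0..<q]))"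
    unfolding minor_leibniz assms(2) by (subst sum.swap) (simp add: sum_distrib_left)
  finally show ?thesis .
qed

context ordered_terms
begin

lemma in_wedge_greatest:
  assumes "Delta_Supp n m q tlt W \<noteq> {}"
  shows "in_wedge n m q tlt W \<in> Delta_Supp n m q tlt W"
    "\<And>M. M \<in> Delta_Supp n m q tlt W \<Longrightarrow> M \<noteq> in_wedge n m q tlt W \<Longrightarrow>
      TT_less tlt M (in_wedge n m q tlt W)"
proof -
  obtain L where L: "L \<in> Delta_Supp n m q tlt W"
    "\<And>M. M \<in> Delta_Supp n m q tlt W \<Longrightarrow> M \<noteq> L \<Longrightarrow> TT_less tlt M L"
    using greatest_TT[of "Delta_Supp n m q tlt W"] assms by (auto simp: Delta_Supp_def)
  then have "in_wedge n m q tlt W = L"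
    unfolding in_wedge_def by (intro greatest_wrt_eqI asymp_on_Delta_Supp) auto
  with L show "in_wedge n m q tlt W \<in> Delta_Supp n m q tlt W"
    "\<And>M. M \<in> Delta_Supp n m q tlt W \<Longrightarrow> M \<noteq> in_wedge n m q tlt W \<Longrightarrow>
      TT_less tlt M (in_wedge n m q tlt W)"
    by auto
qed

lemma gin_wedge_eq: "gin_wedge n m q tlt {V} = in_wedge n m q tlt (orbit n V)"
  by (simp add: gin_wedge_def in_wedge_def)

lemma gin_wedge_greatest:
  assumes "V \<in> Gr n m q" "q > 0"
  shows "gin_wedge n m q tlt {V} \<in> Delta_Supp n m q tlt (orbit n V)"
    "\<And>M. M \<in> Delta_Supp n m q tlt (orbit n V) \<Longrightarrow> M \<noteq> gin_wedge n m q tlt {V} \<Longrightarrow>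
      TT_less tlt M (gin_wedge n m q tlt {V})"
proof -
  have "keys f \<subseteq> terms n" if "f \<in> V" for f
    using that assms(1) terms_deg_subset_terms[of n m] unfolding Gr_def homogeneous_def by blast
  then have "act n (1\<^sub>m (n + 1)) ` V = V" using act_one_mat by force
  then have "V \<in> orbit n V" unfolding orbit_def using GL_one by blast
  then have "Delta_Supp n m q tlt (orbit n V) \<noteq> {}"
    using initial_space_eq_vs(2)[OF assms] by (auto simp: Delta_Supp_def)
  from in_wedge_greatest[OF this]
  show "gin_wedge n m q tlt {V} \<in> Delta_Supp n m q tlt (orbit n V)"
    "\<And>M. M \<in> Delta_Supp n m q tlt (orbit n V) \<Longrightarrow> M \<noteq> gin_wedge n m q tlt {V} \<Longrightarrow>
      TT_less tlt M (gin_wedge n m q tlt {V})"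
    unfolding gin_wedge_eq by auto
qed

text \<open>The support of \<open>W\<close> lies inside that of the orbit, so its maximum cannot
  exceed the generic one; as soon as the generic wedge occurs for \<open>W\<close>, the two
  coincide.\<close>

lemma in_wedge_eq_gin_wedge:
  assumes V: "V \<in> Gr n m q" "q > 0" and "W \<in> orbit n V" "W \<in> Gr n m q"
    and L: "gin_wedge n m q tlt {V} \<in> Delta_Supp n m q tlt {W}"
  shows "in_wedge n m q tlt {W} = gin_wedge n m q tlt {V}"
proof (rule ccontr)
  assume ne: "in_wedge n m q tlt {W} \<noteq> gin_wedge n m q tlt {V}"
  have sub: "Delta_Supp n m q tlt {W} \<subseteq> Delta_Supp n m q tlt (orbit n V)"
    using assms(3) by (auto simp: Delta_Supp_def)
  have "TT_less tlt (gin_wedge n m q tlt {V}) (in_wedge n m q tlt {W})"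
    using in_wedge_greatest(2)[OF _ L ne[symmetric]] L by blast
  moreover have "TT_less tlt (in_wedge n m q tlt {W}) (gin_wedge n m q tlt {V})"
    using gin_wedge_greatest(2)[OF V] sub in_wedge_greatest(1)[of m q "{W}"] L ne by blast
  ultimately show False
    using asymp_onD[OF asymp_on_Delta_Supp] gin_wedge_greatest(1)[OF V] sub
      in_wedge_greatest(1)[of m q "{W}"] L by blast
qed

lemma gin_space_eq_vs:
  fixes V :: "'k::field pol set"
  assumes inf: "infinite (UNIV :: 'k set)" and V: "V \<in> Gr n m q" "q > 0"
    and fs: "V = pm.span (set fs)" "length fs = q"
  shows "gin_space n tlt V = vs (gin_wedge n m q tlt {V})"
proof -
  define L where "L = gin_wedge n m q tlt {V}"
  \<comment> \<open>The translates at which the generic wedge survives; some \<open>g\<close>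
    qualifies because that wedge occurs in the support of the orbit.\<close>
  define U where "U = {g \<in> GL n. minor L (map (act n g) fs) \<noteq> 0}"
  have L: "L \<in> TT n m q tlt" using gin_wedge_greatest(1)[OF V] by (simp add: L_def Delta_Supp_def)
  have gV: "act n g ` V = pm.span (set (map (act n g) fs))" for g
    by (simp add: fs(1) act_span)
  have mem_U: "act n g ` V \<in> U_open n m q tlt L \<longleftrightarrow> minor L (map (act n g) fs) \<noteq> 0" if "g \<in> GL n" for g
    using mem_U_open_iff[OF act_Gr[OF V(1) that] gV _ L] fs(2) by simp
  obtain g where "g \<in> GL n" "act n g ` V \<in> U_open n m q tlt L"
    using gin_wedge_greatest(1)[OF V] by (auto simp: L_def Delta_Supp_def orbit_def)
  with mem_U have "U \<noteq> {}" by (auto simp: U_def)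
  have "keys f \<subseteq> terms n" if "f \<in> set fs" for f
    using that Gr_basis_subset[OF V(1) fs(1)] terms_deg_subset_terms[of n m]
    unfolding homogeneous_def by blast
  then have "zariski_open_GL n U"
    unfolding U_def using L fs(2) by (intro zariski_open_regular_fun regular_fun_minor_act) (auto simp: TT_D(1))
  have U_const: "initial_space tlt (act n g ` V) = vs L" if "g \<in> U" for g
  proof -
    have g: "g \<in> GL n" "act n g ` V \<in> U_open n m q tlt L"
      using that mem_U by (auto simp: U_def)
    then have "in_wedge n m q tlt {act n g ` V} = L"
      unfolding L_def using L
      by (intro in_wedge_eq_gin_wedge V act_Gr) (auto simp: orbit_def Delta_Supp_def L_def)
    then show ?thesis using initial_space_eq_vs(1)[OF act_Gr[OF V(1) g(1)] V(2)] by simp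
  qed
  show ?thesis
    unfolding gin_space_def L_def[symmetric]
  proof (rule the_equality)
    show "\<exists>U. zariski_open_GL n U \<and> U \<noteq> {} \<and> (\<forall>g\<in>U. initial_space tlt (act n g ` V) = vs L)"
      using \<open>zariski_open_GL n U\<close> \<open>U \<noteq> {}\<close> U_const by blast
  next
    fix W
    assume "\<exists>U. zariski_open_GL n U \<and> U \<noteq> {} \<and> (\<forall>g\<in>U. initial_space tlt (act n g ` V) = W)"
    then obtain U' where U': "zariski_open_GL n U'" "U' \<noteq> {}"
      "\<And>g. g \<in> U' \<Longrightarrow> initial_space tlt (act n g ` V) = W" by blast
    \<comment> \<open>Uniqueness of the generic value: a competing open set must meet
      \<open>U\<close>.\<close>
    obtain g where "g \<in> U" "g \<in> U'"
      using zariski_open_GL_intersect[OF inf \<open>zariski_open_GL n U\<close> \<open>U \<noteq> {}\<close> U'(1,2)] by blast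
    then show "W = vs L" using U_const[of g] U'(3)[of g] by simp
  qed
qed

text \<open>The heart of the Borel property: after acting with the torus element having the entries
  \<open>x ^ (B ^ i)\<close>, the minor is a polynomial in \<open>x\<close>. By uniqueness of base \<open>B\<close> expansions, its
  coefficient at the exponent of \<open>\<tau>\<^sub>1 \<cdots> \<tau>\<^sub>q\<close> comes only from choices of terms of the basis elements
  with the same product, and since all terms are at most the leading ones, only from the leading terms.\<close>

lemma torus_minor_nonzero:
  fixes hs :: "'k::field pol list" and g :: "'k mat"
  assumes inf: "infinite (UNIV :: 'k set)"
    and L: "L \<in> TT n m q tlt" and hs: "length hs = q" "set hs \<subseteq> homogeneous n m"
    and lead: "\<And>i. i < q \<Longrightarrow> lookup (hs ! i) (L ! i) \<noteq> 0"
    and le: "\<And>i t. i < q \<Longrightarrow> t \<in> keys (hs ! i) \<Longrightarrow> tle t (L ! i)"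
    and M: "length M = q" "minor M (map (\<lambda>t. act n g (term_pol t)) L) \<noteq> 0" and g: "g \<in> GL n"
  obtains G where "G \<in> GL n" "minor M (map (act n G) hs) \<noteq> 0"
proof -
  \<comment> \<open>An exponent in a product of \<open>q\<close> terms of degree \<open>m\<close> is
    at most \<open>q * m\<close>, so it is a digit in base \<open>B\<close>.\<close>
  define B where "B = Suc (q * m)"
  define A where "A = terms_deg n m"
  define enc where "enc t = (\<Sum>v\<le>n. lookup t v * B ^ v)" for t :: trm
  \<comment> \<open>With these weights a term \<open>t\<close> is multiplied by
    \<open>x ^ enc t\<close> before \<open>g\<close> acts, \<open>enc\<close> reading the exponents
    of \<open>t\<close> as digits in base \<open>B\<close>.\<close>
  define G where "G x = mat (n + 1) (n + 1) (\<lambda>(i, j). x ^ (B ^ i) * g $$ (i, j))" for x :: 'k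
  define S where "S = PiE {0..<q} (\<lambda>_. A)"
  define c where "c s = (\<Prod>i = 0..<q. lookup (hs ! i) (s i)) *
    minor M (map (\<lambda>i. act n g (term_pol (s i))) [0..<q])" for s
  define e where "e s = enc (\<Sum>i = 0..<q. s i)" for s :: "nat \<Rightarrow> trm"
  \<comment> \<open>The choice of the leading term in each row. \<open>restrict\<close> puts it into
    the extensional function space \<open>S\<close>, where equality can be checked on indices below
    \<open>q\<close>.\<close>
  define \<tau> where "\<tau> = restrict ((!) L) {0..<q}"
  define R where "R = (\<Sum>s\<in>S. monom (c s) (e s))"
  have A: "finite A" "A \<subseteq> terms n" by (auto simp: A_def finite_terms_deg terms_deg_subset_terms)
  then have "finite S" by (auto simp: S_def intro: finite_PiE)
  have hs_keys: "keys (hs ! i) \<subseteq> A" if "i < q" for i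
    using that hs nth_mem[of i hs] unfolding homogeneous_def A_def by blast
  have \<tau>: "\<tau> \<in> S" using TT_D(3)[OF L] by (auto simp: \<tau>_def S_def A_def)
  have S_D: "s i \<in> A" if "s \<in> S" "i < q" for s i using that by (auto simp: S_def)
  have monom_val_enc: "monom_val (\<lambda>i. x ^ (B ^ i)) t = x ^ enc t" if "t \<in> A" for t and x :: 'k
  proof -
    have "monom_val (\<lambda>i. x ^ (B ^ i)) t = (\<Prod>v\<le>n. (x ^ (B ^ v)) ^ lookup t v)"
      using that A(2) by (intro monom_val_superset) (auto simp: terms_def)
    then show ?thesis by (simp add: enc_def power_sum mult.commute flip: power_mult)
  qed
  have enc_sum: "enc (\<Sum>i\<in>I. s i) = (\<Sum>i\<in>I. enc (s i))" for I :: "nat set" and s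
    unfolding enc_def lookup_sum sum_distrib_right by (rule sum.swap)
  have "poly R x = minor M (map (act n (G x)) hs)" for x
  proof -
    have rows: "map (act n (G x)) hs ! i =
        (\<Sum>t\<in>A. pm_scale (lookup (hs ! i) t * x ^ enc t) (act n g (term_pol t)))" if "i < q" for i
    proof -
      have "act n (G x) (term_pol t) = pm_scale (x ^ enc t) (act n g (term_pol t))" if "t \<in> A" for t
        unfolding G_def using that A(2) by (subst act_scale_rows) (auto simp: monom_val_enc)
      then have "act n (G x) (hs ! i) =
          (\<Sum>t\<in>A. pm_scale (lookup (hs ! i) t) (pm_scale (x ^ enc t) (act n g (term_pol t))))"
        unfolding act_terms_expand[OF A(1) hs_keys[OF \<open>i < q\<close>]] by simp
      then show ?thesis using that hs(1) by simp
    qed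
    have "minor M (map (act n (G x)) hs) = (\<Sum>s\<in>S.
        (\<Prod>i = 0..<q. lookup (hs ! i) (s i) * x ^ enc (s i)) *
        minor M (map (\<lambda>i. act n g (term_pol (s i))) [0..<q]))"
      unfolding S_def by (rule minor_sum_rows[OF A(1) M(1) rows])
    then show ?thesis
      unfolding R_def c_def e_def enc_sum
      by (simp add: poly_sum poly_monom prod.distrib power_sum algebra_simps)
  qed
  moreover have "R \<noteq> 0"
  proof -
    have uniq: "s = \<tau>" if s: "s \<in> S" "c s \<noteq> 0" "e s = e \<tau>" for s
    proof -
      have le': "tle (s i) (\<tau> i)" if "i < q" for i
        using s(2) that le[OF that] by (auto simp: c_def \<tau>_def in_keys_iff)
      have bound: "lookup (\<Sum>i = 0..<q. s i) v < B" if "s \<in> S" for s v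
      proof -
        have "(\<Sum>i = 0..<q. lookup (s i) v) \<le> (\<Sum>i = 0..<q. m)"
          using S_D[OF that] by (intro sum_mono lookup_le_of_mem_terms_deg[of _ n]) (auto simp: A_def)
        then show ?thesis by (simp add: B_def lookup_sum)
      qed
      have terms: "(\<Sum>i = 0..<q. s i) \<in> terms n" if "s \<in> S" for s
        using S_D[OF that] A(2) by (intro terms_sum) auto
      have "\<forall>v\<le>n. lookup (\<Sum>i = 0..<q. s i) v = lookup (\<Sum>i = 0..<q. \<tau> i) v"
        using s(3) bound[OF s(1)] bound[OF \<tau>] unfolding e_def enc_def by (intro base_digits_inject) auto
      then have "(\<Sum>i = 0..<q. s i) = (\<Sum>i = 0..<q. \<tau> i)"
        using terms[OF s(1)] terms[OF \<tau>]
        by (intro poly_mapping_eqI) (metis atMost_iff in_keys_iff mem_Collect_eq subsetD terms_def)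
      then have "\<forall>i\<in>{0..<q}. s i = \<tau> i"
        using tle_sum[of "{0..<q}" s \<tau>] le' S_D[OF s(1)] S_D[OF \<tau>] A(2) by (auto simp: subset_iff)
      then show ?thesis using s(1) \<tau> unfolding S_def by (intro PiE_ext) auto
    qed
    have "coeff R (e \<tau>) = (\<Sum>s\<in>S. if s = \<tau> then c s else 0)"
      unfolding R_def coeff_sum using uniq by (intro sum.cong) auto
    also have "\<dots> = c \<tau>" using \<tau> \<open>finite S\<close> by simp
    also have "c \<tau> \<noteq> 0"
    proof -
      have "minor M (map (\<lambda>i. act n g (term_pol (\<tau> i))) [0..<q])
          = minor M (map (\<lambda>t. act n g (term_pol t)) L)"
        using M(1) L by (intro minor_cong) (auto simp: \<tau>_def TT_D(1))
      then show ?thesis using M(2) lead by (simp add: c_def \<tau>_def)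
    qed
    finally show ?thesis by auto
  qed
  \<comment> \<open>The factor \<open>[:0, 1:]\<close> forces \<open>x \<noteq> 0\<close>, so that
    the torus weights are non-zero and \<open>G x\<close> is invertible.\<close>
  ultimately obtain x where x: "poly (R * [:0, 1:]) x \<noteq> 0"
    using poly_nonzero_point[OF inf, of "R * [:0, 1:]"] by auto
  show thesis
  proof
    show "G x \<in> GL n" unfolding G_def using x by (intro scale_rows_GL g) auto
    show "minor M (map (act n (G x)) hs) \<noteq> 0"
      using x \<open>\<And>x. poly R x = minor M (map (act n (G x)) hs)\<close> by auto
  qed
qed

lemma Borel_gin_wedge:
  fixes V :: "'k::field pol set"
  assumes inf: "infinite (UNIV :: 'k set)" and V: "V \<in> Gr n m q" "q > 0"
  shows "Borel TYPE('k) n (gin_wedge n m q tlt {V})"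
  unfolding Borel_def
proof (intro ballI impI)
  fix g :: "'k mat" assume g: "g \<in> GL n" "upper_triangular g"
  define L where "L = gin_wedge n m q tlt {V}"
  have L: "L \<in> TT n m q tlt" using gin_wedge_greatest(1)[OF V] by (simp add: L_def Delta_Supp_def)
  obtain \<gamma> where \<gamma>: "\<gamma> \<in> GL n" "act n \<gamma> ` V \<in> U_open n m q tlt L"
    using gin_wedge_greatest(1)[OF V] by (auto simp: L_def Delta_Supp_def orbit_def)
  \<comment> \<open>\<open>V\<close> need not have \<open>L\<close> as its own initial wedge.
    Maximality of \<open>L\<close> concerns the whole orbit, so passing to a translate that attains
    \<open>L\<close> loses nothing and provides an echelon basis with leading list
    \<open>L\<close>.\<close>
  define W where "W = act n \<gamma> ` V"
  have W: "W \<in> Gr n m q" using act_Gr[OF V(1) \<gamma>(1)] by (simp add: W_def)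
  have in_W: "in_wedge n m q tlt {W} = L"
    unfolding L_def using \<gamma> L
    by (intro in_wedge_eq_gin_wedge V W) (auto simp: W_def orbit_def Delta_Supp_def L_def)
  obtain L' hs where hs: "L' \<in> TT n m q tlt" "length hs = q" "W = pm.span (set hs)"
    "\<And>i. i < q \<Longrightarrow> lookup (hs ! i) (L' ! i) \<noteq> 0"
    "\<And>i t. i < q \<Longrightarrow> t \<in> keys (hs ! i) \<Longrightarrow> tle t (L' ! i)"
    using echelon_basis[OF W V(2)] by blast
  have [simp]: "L' = L" using in_wedge_echelon(1)[OF W hs(3,2,1,4,5)] in_W by simp
  let ?gL = "map (\<lambda>t. act n g (term_pol t)) L :: 'k pol list"
  have zero: "minor M ?gL = 0" if M: "M \<in> TT n m q tlt" "M \<noteq> L" for M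
  proof (rule ccontr)
    assume nz: "minor M ?gL \<noteq> 0"
    have "tle (L ! i) t" if "i < q" "t \<in> keys (?gL ! i)" for i t
      using act_upper_triangular_ge[OF g(2) GL_carrier[OF g(1)]] that L by (auto simp: TT_D)
    then have less: "TT_less tlt L M"
      using minor_nonzero_ge[OF L M(1) nz] M(2) by blast
    \<comment> \<open>With \<open>g\<close> alone the minor at \<open>M\<close> could be cancelled
      by the non-leading terms of \<open>hs\<close>; \<open>G\<close> includes the torus
      correction.\<close>
    obtain G where G: "G \<in> GL n" "minor M (map (act n G) hs) \<noteq> 0"
      using torus_minor_nonzero[OF inf L hs(2) Gr_basis_subset[OF W hs(3)] _ _ _ nz g(1)] hs(4,5)
        TT_D(1)[OF M(1)] by auto
    have span: "act n G ` W = pm.span (set (map (act n G) hs))"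
      by (simp add: hs(3) act_span)
    have "act n G ` W \<in> U_open n m q tlt M"
      using mem_U_open_iff[OF act_Gr[OF W G(1)] span _ M(1)] G(2) hs(2) by simp
    moreover have "act n G ` W \<in> orbit n V"
      unfolding W_def by (rule orbit_act[OF V(1) \<gamma>(1) G(1)])
    ultimately have "M \<in> Delta_Supp n m q tlt (orbit n V)"
      using M(1) by (auto simp: Delta_Supp_def)
    then have "TT_less tlt M L"
      using gin_wedge_greatest(2)[OF V] M(2) by (simp add: L_def)
    with less show False
      using asymp_onD[OF asymp_on_TT_less[OF subset_refl] L M(1)] by blast
  qed
  have "set ?gL \<subseteq> homogeneous n m"
    using L by (auto simp: TT_def intro!: act_homogeneous term_pol_homogeneous)
  from wedge_eq_sum_minors[OF this]
  have "wedge ?gL = (\<Sum>M\<in>TT n m q tlt. ext_scale (minor M ?gL) (wedge_terms M))"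
    using L by (simp add: TT_D(1))
  also have "\<dots> = (\<Sum>M\<in>{L}. ext_scale (minor M ?gL) (wedge_terms M))"
    using L zero by (intro sum.mono_neutral_right finite_TT) auto
  finally show "wedge (map (\<lambda>t. act n g (term_pol t)) (gin_wedge n m q tlt {V}))
      \<in> ext.span {wedge_terms (gin_wedge n m q tlt {V})}"
    unfolding L_def[symmetric] by (simp add: ext.span_scale ext.span_base)
qed

end

theorem theorem2p7:
  fixes n m q :: nat
    and tlt :: "trm \<Rightarrow> trm \<Rightarrow> bool"
    and V :: "'k::field pol set"
    and fs :: "'k pol list"
    and c :: "trm list \<Rightarrow> 'k"
  assumes "infinite (UNIV :: 'k set)"
    and "m > 0" and "q > 0"
    and "term_order n tlt"
    and "V \<in> Gr n m q"
    and "length fs = q" and "V = pm.span (set fs)"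
    and "wedge fs = (\<Sum>L\<in>TT n m q tlt. ext_scale (c L) (wedge_terms L))"
  shows "Delta_Supp n m q tlt {V} = {L \<in> TT n m q tlt. c L \<noteq> 0}
       \<and> ext_power q (initial_space tlt V) = ext.span {wedge_terms (in_wedge n m q tlt {V})}
       \<and> initial_space tlt V = vs (in_wedge n m q tlt {V})
       \<and> ext_power q (gin_space n tlt V) = ext.span {wedge_terms (gin_wedge n m q tlt {V})}
       \<and> gin_space n tlt V = vs (gin_wedge n m q tlt {V})
       \<and> Borel TYPE('k) n (gin_wedge n m q tlt {V})"
proof -
  interpret ordered_terms n tlt by unfold_locales fact
  \<comment> \<open>The coefficients are given only through the expansion of
    \<open>wedge fs\<close>; the dual functionals identify them with minors.\<close>
  have "c L = minor L fs" if L: "L \<in> TT n m q tlt" for L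
  proof -
    have "minor L fs = ext_coord L (wedge fs)"
      using L assms(6) by (simp add: ext_coord_wedge TT_D(1))
    also have "\<dots> = (\<Sum>M\<in>TT n m q tlt. if M = L then c M else 0)"
      unfolding assms(8) ext_coord_sum
      using L by (intro sum.cong) (auto simp: ext_coord_scale ext_coord_wedge_terms)
    finally show ?thesis using L by (simp add: finite_TT)
  qed
  then have "Delta_Supp n m q tlt {V} = {L \<in> TT n m q tlt. c L \<noteq> 0}"
    by (auto simp: Delta_Supp_singleton[OF assms(5,7,6)])
  moreover have "in_wedge n m q tlt {V} \<in> TT n m q tlt" "gin_wedge n m q tlt {V} \<in> TT n m q tlt"
    using initial_space_eq_vs(2)[OF assms(5,3)] gin_wedge_greatest(1)[OF assms(5,3)]
    by (auto simp: Delta_Supp_def)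
  ultimately show ?thesis
    using initial_space_eq_vs(1)[OF assms(5,3)] gin_space_eq_vs[OF assms(1,5,3,7,6)]
      Borel_gin_wedge[OF assms(1,5,3)]
    by (simp add: ext_power_vs TT_D(1))
qed

end
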